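(* Let $s>1/2$ and let $u\in C(\mathbb{R},H^s_+(\mathbb{S}^1))$ be a solution of the truncated Szegő equation $$i\partial_t u=\Pi(|u|^2u)-S\,\Pi\big(|S^\dagger u|^2S^\dagger u\big).$$ Then $(K_u,D_u)$ with $D_u=C_u-B_{S^\dagger u}$ is a Lax pair, i.e. $$\frac{dK_u}{dt}=[D_u,K_u]=D_uK_u-K_uD_u .$$
   Context: $L^2_+(\mathbb{S}^1)$ is the closed subspace of $L^2(\mathbb{S}^1)$ of functions $h=\sum_{n\ge 0}h_ne^{in\theta}$ whose negative Fourier coefficients vanish; $H^s_+(\mathbb{S}^1)=H^s(\mathbb{S}^1)\cap L^2_+(\mathbb{S}^1)$. $\Pi:L^2(\mathbb{S}^1)\to L^2_+(\mathbb{S}^1)$ is the Szegő projector $\Pi(\sum_{n\in\mathbb{Z}}h_ne^{in\theta})=\sum_{n\ge0}h_ne^{in\theta}$. $S$ is the shift $Sh=e^{i\theta}h$ on $L^2_+$, and $S^\dagger$ is its adjoint, $(S^\dagger h)_n=h_{n+1}$ for $n\ge0$. For $u\in H^s_+$ with $s>1/2$, the following operators act on $L^2_+(\mathbb{S}^1)$: the antilinear Hankel operator $H_uh=\Pi(u\bar h)$; the linear Toeplitz operator $T_bh=\Pi(bh)$ for a bounded function $b$ on $\mathbb{S}^1$; the antilinear operator $K_u=S^\dagger H_u=H_uS=H_{S^\dagger u}$; and $$B_u=\tfrac{i}{2}H_u^2-iT_{|u|^2},\qquad C_u=\tfrac{i}{2}K_u^2-iT_{|u|^2}.$$ In particular $B_{S^\dagger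 u}=\tfrac i2 H_{S^\dagger u}^2-iT_{|S^\dagger u|^2}$. *)

theory Defs
  imports "HOL-Analysis.Analysis"
begin

text \<open>Functions on the unit circle are represented by functions \<open>complex \<Rightarrow> complex\<close>, with
  \<open>z = e\<^sup>i\<^sup>\<theta>\<close>. Only their values almost everywhere with respect to normalised arc length matter;
  we work with representatives rather than with equivalence classes.\<close>

type_synonym circle_fun = "complex \<Rightarrow> complex"

definition circle_measure :: "complex measure" where
  "circle_measure = distr (uniform_measure lborel {0..2 * pi}) borel cis"

definition L2 :: "circle_fun set" where
  "L2 = {f. f \<in> borel_measurable circle_measure \<and>
            integrable circle_measure (\<lambda>z. (norm (f z))\<^sup>2)}"

definition L2_norm :: "circle_fun \<Rightarrow> real" where
  "L2_norm f = sqrt (integral\<^sup>L circle_measure (\<lambda>z. (norm (f z))\<^sup>2))"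

definition fourier :: "circle_fun \<Rightarrow> int \<Rightarrow> complex" where
  "fourier f n = integral\<^sup>L circle_measure (\<lambda>z. f z * z powi (- n))"

definition L2_plus :: "circle_fun set" where
  "L2_plus = {f \<in> L2. \<forall>n<0. fourier f n = 0}"

text \<open>\<open>fourier_synth c\<close> is the \<open>L\<^sup>2\<close> function with Fourier series \<open>\<Sum>n. c n * z powi n\<close>. It is
  determined up to a null set and exists precisely when \<open>c\<close> is square summable; it is only used
  for such \<open>c\<close>.\<close>

definition fourier_synth :: "(int \<Rightarrow> complex) \<Rightarrow> circle_fun" where
  "fourier_synth c = (SOME f. f \<in> L2 \<and> (\<forall>n. fourier f n = c n))"

definition Hs :: "real \<Rightarrow> circle_fun set" where
  "Hs s = {f \<in> L2. (\<lambda>n::int. (1 + (real_of_int n)\<^sup>2) powr s * (norm (fourier f n))\<^sup>2) summable_on UNIV}"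

definition Hs_norm :: "real \<Rightarrow> circle_fun \<Rightarrow> real" where
  "Hs_norm s f =
     sqrt (infsum (\<lambda>n::int. (1 + (real_of_int n)\<^sup>2) powr s * (norm (fourier f n))\<^sup>2) UNIV)"

definition Hs_plus :: "real \<Rightarrow> circle_fun set" where
  "Hs_plus s = Hs s \<inter> L2_plus"

definition szego :: "circle_fun \<Rightarrow> circle_fun" where
  "szego f = fourier_synth (\<lambda>n. if n \<ge> 0 then fourier f n else 0)"

definition shift :: "circle_fun \<Rightarrow> circle_fun" where
  "shift h = (\<lambda>z. z * h z)"

text \<open>The adjoint of \<open>shift\<close> as an operator on \<open>L2_plus\<close>.\<close>

definition shift_adj :: "circle_fun \<Rightarrow> circle_fun" where
  "shift_adj h = fourier_synth (\<lambda>n. if n \<ge> 0 then fourier h (n + 1) else 0)"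

definition hankel :: "circle_fun \<Rightarrow> circle_fun \<Rightarrow> circle_fun" where
  "hankel u h = szego (\<lambda>z. u z * cnj (h z))"

definition toeplitz :: "circle_fun \<Rightarrow> circle_fun \<Rightarrow> circle_fun" where
  "toeplitz b h = szego (\<lambda>z. b z * h z)"

definition abs_sq :: "circle_fun \<Rightarrow> circle_fun" where
  "abs_sq u = (\<lambda>z. complex_of_real ((norm (u z))\<^sup>2))"

definition K_op :: "circle_fun \<Rightarrow> circle_fun \<Rightarrow> circle_fun" where
  "K_op u h = shift_adj (hankel u h)"

definition B_op :: "circle_fun \<Rightarrow> circle_fun \<Rightarrow> circle_fun" where
  "B_op u h = (\<lambda>z. \<i> / 2 * hankel u (hankel u h) z - \<i> * toeplitz (abs_sq u) h z)"

definition C_op :: "circle_fun \<Rightarrow> circle_fun \<Rightarrow> circle_fun" where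
  "C_op u h = (\<lambda>z. \<i> / 2 * K_op u (K_op u h) z - \<i> * toeplitz (abs_sq u) h z)"

definition D_op :: "circle_fun \<Rightarrow> circle_fun \<Rightarrow> circle_fun" where
  "D_op u h = (\<lambda>z. C_op u h z - B_op (shift_adj u) h z)"

definition commutator ::
  "(circle_fun \<Rightarrow> circle_fun) \<Rightarrow> (circle_fun \<Rightarrow> circle_fun) \<Rightarrow> circle_fun \<Rightarrow> circle_fun" where
  "commutator A B h = (\<lambda>z. A (B h) z - B (A h) z)"

definition continuous_Hs_plus :: "real \<Rightarrow> (real \<Rightarrow> circle_fun) \<Rightarrow> bool" where
  "continuous_Hs_plus s u \<longleftrightarrow>
     (\<forall>t. u t \<in> Hs_plus s) \<and>
     (\<forall>t. ((\<lambda>r. Hs_norm s (\<lambda>z. u r z - u t z)) \<longlongrightarrow> 0) (at t))"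

definition szego_cubic :: "circle_fun \<Rightarrow> circle_fun" where
  "szego_cubic v = szego (\<lambda>z. abs_sq v z * v z)"

definition truncated_szego_field :: "circle_fun \<Rightarrow> circle_fun" where
  "truncated_szego_field v =
     (\<lambda>z. szego_cubic v z - shift (szego_cubic (shift_adj v)) z)"

text \<open>The time derivative is the limit of difference quotients in \<open>L\<^sup>2\<close>. This is weaker than
  differentiability in \<open>H\<^sup>s\<close>, so solutions in the latter sense are included.\<close>

definition solves_truncated_szego :: "(real \<Rightarrow> circle_fun) \<Rightarrow> bool" where
  "solves_truncated_szego u \<longleftrightarrow>
     (\<forall>t. ((\<lambda>r. L2_norm (\<lambda>z. \<i> * ((u r z - u t z) / complex_of_real (r - t))
                              - truncated_szego_field (u t) z)) \<longlongrightarrow> 0) (at t))"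

text \<open>Linearity is over the reals, because the antilinear operators are to be included.\<close>

definition bounded_real_linear_op :: "(circle_fun \<Rightarrow> circle_fun) \<Rightarrow> bool" where
  "bounded_real_linear_op A \<longleftrightarrow>
     (\<forall>f\<in>L2_plus. A f \<in> L2_plus) \<and>
     (\<forall>f\<in>L2_plus. \<forall>g\<in>L2_plus.
        AE z in circle_measure. A (\<lambda>w. f w + g w) z = A f z + A g z) \<and>
     (\<forall>c::real. \<forall>f\<in>L2_plus.
        AE z in circle_measure. A (\<lambda>w. complex_of_real c * f w) z = complex_of_real c * A f z) \<and>
     (\<exists>C. \<forall>f\<in>L2_plus. L2_norm (A f) \<le> C * L2_norm f)"

text \<open>Differentiability in operator norm, in the space of bounded real-linear operators on
  \<open>L2_plus\<close>.\<close>

definition op_has_derivative ::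
  "(real \<Rightarrow> circle_fun \<Rightarrow> circle_fun) \<Rightarrow> (circle_fun \<Rightarrow> circle_fun) \<Rightarrow> real \<Rightarrow> bool" where
  "op_has_derivative A A' t \<longleftrightarrow>
     (\<forall>r. bounded_real_linear_op (A r)) \<and> bounded_real_linear_op A' \<and>
     (\<forall>\<epsilon>>0. \<forall>\<^sub>F r in at t. \<forall>h\<in>L2_plus.
        L2_norm (\<lambda>z. (A r h z - A t h z) / complex_of_real (r - t) - A' h z) \<le> \<epsilon> * L2_norm h)"

end

theory Submission imports Defs
begin

text \<open>
  Write \<open>w = u / z\<close> and \<open>v = shift_adj u\<close>. On \<open>L2_plus\<close> the operator \<open>K_op u\<close> is the Hankel operator
  of either symbol, so the squares of Hankel operators in \<open>D_op u\<close> cancel and \<open>D_op u\<close> is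
  \<open>- \<i>\<close> times the Toeplitz operator with symbol \<open>\<bar>u\<bar>\<^sup>2 - \<bar>v\<bar>\<^sup>2\<close>. The classical identity
  \<open>H(\<bar>w\<bar>\<^sup>2 w) = T(\<bar>w\<bar>\<^sup>2) H(w) + H(w) T(\<bar>w\<bar>\<^sup>2) - H(w)\<^sup>3\<close> holds for \<open>w\<close> as well as for \<open>v\<close>; the cubes
  cancel in the difference, and the commutator is the Hankel operator with symbol
  \<open>- \<i> (\<bar>w\<bar>\<^sup>2 w - \<bar>v\<bar>\<^sup>2 v)\<close>, which has the same nonnegative frequencies as \<open>w\<close> differentiated in time.

  The equation gives this time derivative only in \<open>L\<^sup>2\<close>, which does not control the operator norm.
  But the commutator symbol is continuous in time with values in \<open>L\<^sup>\<infinity>\<close>, because \<open>H\<^sup>s\<close> embeds into the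
  Wiener algebra. Pairing \<open>K_op (u r) h\<close> with \<open>g\<close> for fixed \<open>h\<close>, \<open>g\<close> gives a scalar function of time,
  and the mean value inequality bounds its difference quotients uniformly in \<open>h\<close> and \<open>g\<close>.
\<close>

section \<open>Normalised arc length\<close>

text \<open>\<open>K_op u\<close> is antilinear, so the factor -\<i> of \<open>D_op u\<close>
  changes sign when pulled through it. With T the Toeplitz part, the commutator is -\<i> (T K + K
  T): a sum, as in the two mixed terms of the cubic identity. Both symbols are needed:
  \<open>w\<close> has the modulus of \<open>u\<close> on the circle, so |u|^2 becomes |w|^2, but it
  may have the frequency -1; \<open>v\<close> is analytic and occurs in
  \<open>B_op (shift_adj u)\<close>. They differ by a multiple of 1/z, invisible to Hankel operators
  on \<open>L2_plus\<close>, hence the cubes agree.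

  Since \<open>fourier_synth\<close> is a choice, statements about \<open>szego\<close> rest on
  existence (Riesz-Fischer) and on uniqueness up to null sets. Operators are then compared through
  nonnegative coefficients.

  The product of the conjugates of h and g is only integrable, so the equation, known in
  \<open>L2\<close>, cannot be tested against it directly. The pairing is differentiated for bounded
  h, and the estimate, which does not involve the bound of h, is extended by density.\<close>

lemma sets_circle_measure [simp, measurable_cong]: "sets circle_measure = sets borel"
  by (simp add: circle_measure_def)

lemma space_circle_measure [simp]: "space circle_measure = UNIV"
  by (simp add: circle_measure_def)

lemma measurable_cis [measurable]: "cis \<in> borel_measurable borel"
  by (intro borel_measurable_continuous_onI continuous_intros)

lemma emeasure_uniform_space:
  "emeasure (uniform_measure lborel {0..2 * pi}) UNIV = 1"
proof -
  have "emeasure lborel {0..2 * pi} / emeasure lborel {0..2 * pi} = 1"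
    using ennreal_divide_self[of "ennreal (2 * pi)"] by simp
  then show ?thesis
    using emeasure_uniform_measure[of "{0..2 * pi}" lborel UNIV] by simp
qed

interpretation circle: finite_measure circle_measure
  by standard (simp add: circle_measure_def emeasure_distr emeasure_uniform_space)

lemma measure_circle_measure [simp]: "measure circle_measure UNIV = 1"
  by (simp add: measure_def circle_measure_def emeasure_distr emeasure_uniform_space)

lemma AE_circle_norm: "AE z in circle_measure. norm z = 1"
  unfolding circle_measure_def by (subst AE_distr_iff) auto

lemma AE_circleI: "(\<And>z. norm z = 1 \<Longrightarrow> P z) \<Longrightarrow> AE z in circle_measure. P z"
  using AE_circle_norm by (auto elim: eventually_mono)

lemma cnj_eq_inverse: "norm z = 1 \<Longrightarrow> cnj z = inverse z" for z :: complex
  by (metis complex_norm_square inverse_unique mult.commute of_real_1 power_one)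

lemma cnj_powi: "norm z = 1 \<Longrightarrow> cnj z powi n = z powi - n" for z :: complex
  by (simp add: cnj_eq_inverse power_int_inverse power_int_minus)

lemma integral_circle_measure:
  fixes f :: "complex \<Rightarrow> complex"
  assumes [measurable]: "f \<in> borel_measurable borel"
  shows "integral\<^sup>L circle_measure f
    = integral\<^sup>L lborel (\<lambda>x. indicator {0..2 * pi} x *\<^sub>R f (cis x)) / (2 * pi)"
proof -
  have "uniform_measure lborel {0..2 * pi}
      = density lborel (\<lambda>x. ennreal (indicator {0..2 * pi} x / (2 * pi)))"
    unfolding uniform_measure_def
    by (intro density_cong AE_I2)
       (auto simp: indicator_def divide_ennreal simp flip: ennreal_1)
  then have "integral\<^sup>L circle_measure f
    = integral\<^sup>L lborel (\<lambda>x. (indicator {0..2 * pi} x / (2 * pi)) *\<^sub>R f (cis x))"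
    unfolding circle_measure_def
    by (simp add: integral_distr integral_density)
  also have "\<dots> = integral\<^sup>L lborel
      (\<lambda>x. inverse (2 * pi) *\<^sub>R (indicator {0..2 * pi} x *\<^sub>R f (cis x)))"
    by (intro Bochner_Integration.integral_cong) (auto simp: field_simps)
  finally show ?thesis
    by (simp only: integral_scaleR_right) (simp add: scaleR_conv_of_real field_simps)
qed

lemma measurable_power_int [measurable]:
  fixes n :: int
  shows "(\<lambda>z::complex. z powi n) \<in> borel_measurable borel"
  unfolding power_int_def by (cases "n \<ge> 0") auto

lemma integral_circle_power_int:
  "(\<integral>z. z powi n \<partial>circle_measure) = (if n = 0 then 1 else 0)"
proof (cases "n = 0")
  case True
  then show ?thesis by simp
next
  case False
  define F where "F = (\<lambda>x. cis (of_int n * x) / (\<i> * of_int n))"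
  have "integral\<^sup>L lborel (\<lambda>x. indicator {0..2 * pi} x *\<^sub>R cis (of_int n * x)) = F (2 * pi) - F 0"
  proof (rule integral_FTC_atLeastAtMost)
    fix x :: real
    have "((\<lambda>x. cis (of_int n * x)) has_vector_derivative
        (of_int n *\<^sub>R (\<i> * cis (of_int n * x)))) (at x within {0..2 * pi})"
      unfolding has_vector_derivative_def
      by (auto intro!: derivative_eq_intros simp: scaleR_conv_of_real algebra_simps)
    then have "(F has_vector_derivative
        ((of_int n *\<^sub>R (\<i> * cis (of_int n * x))) / (\<i> * of_int n))) (at x within {0..2 * pi})"
      unfolding F_def by (rule has_vector_derivative_divide)
    then show "(F has_vector_derivative cis (of_int n * x)) (at x within {0..2 * pi})"
      using False by (simp add: scaleR_conv_of_real)
  qed (auto intro!: continuous_intros)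
  also have "F (2 * pi) = F 0"
    using cis_multiple_2pi[of "of_int n"] by (simp add: F_def mult.commute mult.left_commute)
  finally show ?thesis
    using False by (simp add: integral_circle_measure cis_power_int)
qed

section \<open>Uniqueness of Fourier coefficients\<close>

lemma integrable_mult_circle_bounded:
  fixes f g :: "complex \<Rightarrow> complex"
  assumes "integrable circle_measure f" and [measurable]: "g \<in> borel_measurable borel"
    and "AE z in circle_measure. norm (g z) \<le> B"
  shows "integrable circle_measure (\<lambda>z. g z * f z)"
proof (rule Bochner_Integration.integrable_bound)
  show "integrable circle_measure (\<lambda>z. B * norm (f z))"
    using assms(1) by auto
  show "AE z in circle_measure. norm (g z * f z) \<le> norm (B * norm (f z))"
    using assms(3)
  proof eventually_elim
    case (elim z)
    have "norm (g z) * norm (f z) \<le> B * norm (f z)"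
      by (intro mult_right_mono elim) auto
    then show ?case
      unfolding real_norm_def norm_mult by (rule order_trans[OF _ abs_ge_self])
  qed
  show "(\<lambda>z. g z * f z) \<in> borel_measurable circle_measure"
    using assms(1) by measurable
qed

lemma integrable_powi_mult:
  fixes f :: "complex \<Rightarrow> complex"
  assumes "integrable circle_measure f"
  shows "integrable circle_measure (\<lambda>z. z powi k * f z)"
  by (rule integrable_mult_circle_bounded[OF assms _ AE_circleI[of _ ]])
     (auto simp: norm_power_int)

lemma fourier_mult_powi:
  assumes "integrable circle_measure f"
  shows "fourier (\<lambda>z. z powi k * f z) n = fourier f (n - k)"
  unfolding fourier_def
proof (rule integral_cong_AE)
  show "AE z in circle_measure. z powi k * f z * z powi - n = f z * z powi - (n - k)"
  proof (rule AE_circleI)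
    fix z :: complex assume "norm z = 1"
    then have "z \<noteq> 0" by auto
    then have "z powi - (n - k) = z powi k * z powi - n"
      by (simp flip: power_int_add)
    then show "z powi k * f z * z powi - n = f z * z powi - (n - k)" by simp
  qed
qed (use assms in measurable)

lemma fourier_add:
  assumes "integrable circle_measure f" "integrable circle_measure g"
  shows "fourier (\<lambda>z. f z + g z) n = fourier f n + fourier g n"
  using integrable_powi_mult[OF assms(1), of "-n"] integrable_powi_mult[OF assms(2), of "-n"]
  by (simp add: fourier_def algebra_simps)

lemma fourier_diff:
  assumes "integrable circle_measure f" "integrable circle_measure g"
  shows "fourier (\<lambda>z. f z - g z) n = fourier f n - fourier g n"
  using integrable_powi_mult[OF assms(1), of "-n"] integrable_powi_mult[OF assms(2), of "-n"]
  by (simp add: fourier_def algebra_simps)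

lemma fourier_cmult: "fourier (\<lambda>z. c * f z) n = c * fourier f n"
  by (simp add: fourier_def mult.assoc)

lemma fourier_cong_AE:
  assumes "AE z in circle_measure. f z = g z"
    "f \<in> borel_measurable borel" "g \<in> borel_measurable borel"
  shows "fourier f n = fourier g n"
  unfolding fourier_def using assms by (intro integral_cong_AE) auto

lemma measurable_complex_continuous:
  fixes g :: "complex \<Rightarrow> 'a::real_normed_vector"
  shows "continuous_on UNIV g \<Longrightarrow> g \<in> borel_measurable borel"
  by (rule borel_measurable_continuous_onI)

text \<open>On the unit circle a real polynomial in Re z and Im z is a trigonometric polynomial, and
  multiplying by z^k only shifts the coefficients. The claim keeps integrability and ranges over all
  \<open>f\<close>, because the product case applies the hypothesis for \<open>p\<close> to
  \<open>q\<close> times \<open>f\<close>.\<close>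

lemma fourier_zero_mult_polynomial:
  assumes "real_polynomial_function p" "integrable circle_measure f" "\<And>n. fourier f n = 0"
  shows "integrable circle_measure (\<lambda>z. complex_of_real (p z) * f z)
    \<and> (\<forall>n. fourier (\<lambda>z. complex_of_real (p z) * f z) n = 0)"
  using assms
proof (induction p arbitrary: f rule: real_polynomial_function.induct)
  case (linear p)
  note pl = linear(1) and f = linear(2,3)
  interpret bounded_linear p by (rule pl)
  \<comment> \<open>A real-linear functional on the plane has the form \<alpha> z + \<beta> cnj z;
    both coefficients are read off from its values at 1 and \<i>.\<close>
  define \<alpha> where "\<alpha> = (complex_of_real (p 1) - \<i> * complex_of_real (p \<i>)) / 2"
  define \<beta> where "\<beta> = (complex_of_real (p 1) + \<i> * complex_of_real (p \<i>)) / 2"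
  have p: "complex_of_real (p z) = \<alpha> * z + \<beta> * cnj z" for z
  proof -
    have "p z = p (Re z *\<^sub>R 1 + Im z *\<^sub>R \<i>)"
      by (simp add: scaleR_conv_of_real complex_eq[symmetric] mult.commute)
    also have "\<dots> = Re z * p 1 + Im z * p \<i>"
      by (simp only: add scaleR real_scaleR_def)
    finally show ?thesis
      by (simp add: \<alpha>_def \<beta>_def complex_eq_iff field_simps)
  qed
  have eq: "AE z in circle_measure. complex_of_real (p z) * f z
      = \<alpha> * (z powi 1 * f z) + \<beta> * (z powi (-1) * f z)"
  proof (rule AE_circleI)
    fix z :: complex assume "norm z = 1"
    then show "complex_of_real (p z) * f z = \<alpha> * (z powi 1 * f z) + \<beta> * (z powi (-1) * f z)"
      by (simp add: p cnj_eq_inverse power_int_minus algebra_simps)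
  qed
  have [measurable]: "p \<in> borel_measurable borel"
    by (intro measurable_complex_continuous linear_continuous_on pl)
  have [measurable]: "f \<in> borel_measurable borel"
    using f(1) by (simp cong: measurable_cong_sets)
  have int: "integrable circle_measure (\<lambda>z. \<alpha> * (z powi 1 * f z) + \<beta> * (z powi (-1) * f z))"
    by (intro Bochner_Integration.integrable_add integrable_mult_right integrable_powi_mult f)
  have "fourier (\<lambda>z. complex_of_real (p z) * f z) n = 0" for n
  proof -
    have "fourier (\<lambda>z. complex_of_real (p z) * f z) n
       = fourier (\<lambda>z. \<alpha> * (z powi 1 * f z) + \<beta> * (z powi (-1) * f z)) n"
      by (rule fourier_cong_AE[OF eq]) measurable
    also have "\<dots> = 0"
      by (subst fourier_add)
         (auto simp only: integrable_mult_right integrable_powi_mult f fourier_cmult fourier_mult_powi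
           mult_zero_right add_0)
    finally show ?thesis .
  qed
  moreover have "integrable circle_measure (\<lambda>z. complex_of_real (p z) * f z)"
    using int by (rule integrable_cong_AE[THEN iffD1, rotated -1]) (use eq in auto)
  ultimately show ?case by blast
next
  case (const c)
  then show ?case by (auto simp: fourier_cmult)
next
  case (add p q)
  note p = add.IH(1)[OF add.prems] and q = add.IH(2)[OF add.prems]
  show ?case
    using p q by (auto simp: ring_distribs fourier_add)
next
  case (mult p q)
  note q = mult.IH(2)[OF mult.prems]
  note p = mult.IH(1)[OF q[THEN conjunct1]]
  show ?case
    using p q by (auto simp: mult.assoc)
qed

text \<open>Stone-Weierstrass on the circle: replacing \<open>g\<close> by a polynomial within e
  changes the integral by at most e times the L1 norm of \<open>f\<close>, so integrability of
  \<open>f\<close> suffices.\<close>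

lemma fourier_zero_mult_continuous:
  fixes g :: "complex \<Rightarrow> real"
  assumes f: "integrable circle_measure f" "\<And>n. fourier f n = 0"
    and g: "continuous_on UNIV g"
  shows "(\<integral>z. complex_of_real (g z) * f z \<partial>circle_measure) = 0"
proof -
  define C where "C = (\<integral>z. norm (f z) \<partial>circle_measure)"
  have C: "C \<ge> 0" by (simp add: C_def)
  have [measurable]: "f \<in> borel_measurable borel"
    using f(1) by (simp cong: measurable_cong_sets)
  have scaled: "norm (\<integral>z. complex_of_real (g z) * f z \<partial>circle_measure) \<le> e * C" if "e > 0" for e
  proof -
    obtain p where p: "real_polynomial_function p" "\<And>z. z \<in> sphere 0 1 \<Longrightarrow> \<bar>g z - p z\<bar> < e"
      using Stone_Weierstrass_real_polynomial_function[of "sphere 0 1" g e] g \<open>e > 0\<close>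
      by (metis compact_sphere continuous_on_subset subset_UNIV)
    have pc: "continuous_on UNIV p"
      using p(1) by (simp add: continuous_on_polymonial_function real_polynomial_function_eq)
    note pf = fourier_zero_mult_polynomial[OF p(1) f]
    have "(\<integral>z. complex_of_real (p z) * f z \<partial>circle_measure)
      = fourier (\<lambda>z. complex_of_real (p z) * f z) 0"
      by (simp add: fourier_def)
    then have p0: "(\<integral>z. complex_of_real (p z) * f z \<partial>circle_measure) = 0"
      using pf by simp
    have dm: "(\<lambda>z. complex_of_real (g z - p z)) \<in> borel_measurable borel"
      by (intro measurable_complex_continuous continuous_intros g pc)
    have d: "integrable circle_measure (\<lambda>z. complex_of_real (g z - p z) * f z)"
      by (rule integrable_mult_circle_bounded[OF f(1) dm AE_circleI[of _ ]])
         (use p(2) in \<open>force intro: less_imp_le simp flip: of_real_diff\<close>)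
    have "(\<integral>z. complex_of_real (g z) * f z \<partial>circle_measure) =
      (\<integral>z. complex_of_real (g z - p z) * f z + complex_of_real (p z) * f z \<partial>circle_measure)"
      by (intro Bochner_Integration.integral_cong) (auto simp: algebra_simps)
    also have "\<dots> = (\<integral>z. complex_of_real (g z - p z) * f z \<partial>circle_measure)"
      using Bochner_Integration.integral_add[OF d pf[THEN conjunct1]] p0 by simp
    also have "norm \<dots> \<le> (\<integral>z. norm (complex_of_real (g z - p z) * f z) \<partial>circle_measure)"
      by (rule integral_norm_bound)
    also have "\<dots> \<le> (\<integral>z. e * norm (f z) \<partial>circle_measure)"
    proof (rule integral_mono_AE)
      show "AE z in circle_measure. norm (complex_of_real (g z - p z) * f z) \<le> e * norm (f z)"
        by (rule AE_circleI, unfold norm_mult norm_of_real, rule mult_right_mono)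
           (use p(2) in \<open>auto intro: less_imp_le\<close>)
    qed (use d f(1) in auto)
    also have "\<dots> = e * C" by (simp add: C_def)
    finally show ?thesis .
  qed
  have "norm (\<integral>z. complex_of_real (g z) * f z \<partial>circle_measure) \<le> e" if "e > 0" for e
  proof -
    have "e / (C + 1) * C \<le> e"
      using C that by (simp add: field_simps)
    then show ?thesis
      using scaled[of "e / (C + 1)"] that C by (simp add: add_nonneg_pos)
  qed
  then have "norm (\<integral>z. complex_of_real (g z) * f z \<partial>circle_measure) \<le> 0"
    by (rule field_le_epsilon[of _ 0, simplified])
  then show ?thesis by simp
qed

text \<open>Closed sets are a generator stable under intersection. Their indicators are pointwise
  limits of continuous functions bounded by 1, and a Dynkin class argument reaches all Borel
  sets.\<close>

lemma fourier_zero_set_integral: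
  assumes f: "integrable circle_measure f" "\<And>n. fourier f n = 0" and A: "A \<in> sets borel"
  shows "set_lebesgue_integral circle_measure A f = 0"
proof -
  have [measurable]: "f \<in> borel_measurable borel"
    using f(1) by (simp cong: measurable_cong_sets)
  have set_int: "set_integrable circle_measure B f" if "B \<in> sets borel" for B
    unfolding set_integrable_def using that f(1) by (intro integrable_mult_indicator) auto
  have UNIV: "set_lebesgue_integral circle_measure UNIV f = 0"
    using f(2)[of 0] by (simp add: set_lebesgue_integral_def fourier_def)
  have closed: "set_lebesgue_integral circle_measure B f = 0" if "closed B" for B
  proof (cases "B = {}")
    case False
    \<comment> \<open>For k > 0 a tent equal to 1 on \<open>B\<close> and to 0 from distance 1/k on.
      For the empty set \<open>infdist\<close> is 0 everywhere and the tents would not tend to the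
      indicator, hence the separate case.\<close>
    define g where "g = (\<lambda>(k::nat) z. max 0 (1 - real k * infdist z B))"
    have gc: "continuous_on UNIV (g k)" for k
      unfolding g_def by (intro continuous_intros)
    have "(\<lambda>k. \<integral>z. complex_of_real (g k z) * f z \<partial>circle_measure)
      \<longlonglongrightarrow> (\<integral>z. complex_of_real (indicator B z) * f z \<partial>circle_measure)"
    proof (rule integral_dominated_convergence[where w = "\<lambda>z. norm (f z)"])
      have "B \<in> sets borel" using \<open>closed B\<close> by auto
      then show "(\<lambda>z. complex_of_real (indicator B z) * f z) \<in> borel_measurable circle_measure"
        by measurable
      show "(\<lambda>z. complex_of_real (g k z) * f z) \<in> borel_measurable circle_measure" for k
        using measurable_complex_continuous[OF gc[of k]] by measurable
      show "integrable circle_measure (\<lambda>z. norm (f z))" using f(1) by auto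
      show "AE z in circle_measure. norm (complex_of_real (g k z) * f z) \<le> norm (f z)" for k
        by (rule AE_I2)
           (auto simp: g_def norm_mult infdist_nonneg intro!: mult_left_le_one_le)
      show "AE z in circle_measure. (\<lambda>k. complex_of_real (g k z) * f z)
        \<longlonglongrightarrow> complex_of_real (indicator B z) * f z"
      proof (rule AE_I2)
        fix z
        have "(\<lambda>k. g k z) \<longlonglongrightarrow> indicator B z"
        proof (cases "z \<in> B")
          case True
          then show ?thesis by (simp add: g_def)
        next
          case no: False
          then have pos: "infdist z B > 0"
            using \<open>closed B\<close> \<open>B \<noteq> {}\<close> infdist_nonneg[of z B] in_closed_iff_infdist_zero[of B z] by force
          then obtain N :: nat where N: "1 / infdist z B < real N"
            using reals_Archimedean2 by blast
          have "g k z = 0" if "k \<ge> N" for k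
          proof -
            have "1 < real N * infdist z B" using N pos by (simp add: field_simps)
            also have "\<dots> \<le> real k * infdist z B"
              using that pos by (intro mult_right_mono) auto
            finally show ?thesis by (simp add: g_def)
          qed
          then have "\<forall>\<^sub>F k in sequentially. g k z = 0"
            unfolding eventually_sequentially by blast
          then show ?thesis using no by (simp add: tendsto_eventually)
        qed
        then show "(\<lambda>k. complex_of_real (g k z) * f z)
          \<longlonglongrightarrow> complex_of_real (indicator B z) * f z"
          by (intro tendsto_intros)
      qed
    qed
    then have "(\<integral>z. complex_of_real (indicator B z) * f z \<partial>circle_measure) = 0"
      using fourier_zero_mult_continuous[OF f gc] LIMSEQ_unique tendsto_const
      by (simp add: LIMSEQ_const_iff)
    then show ?thesis
      by (simp add: set_lebesgue_integral_def scaleR_conv_of_real)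
  qed (simp add: set_lebesgue_integral_def)
  have "Int_stable (Collect (closed :: complex set \<Rightarrow> bool))"
    "Collect (closed :: complex set \<Rightarrow> bool) \<subseteq> Pow UNIV" "A \<in> sigma_sets UNIV (Collect closed)"
    using A by (auto simp: Int_stable_def borel_eq_closed)
  then show ?thesis
  proof (induction rule: sigma_sets_induct_disjoint)
    case (basic B)
    then show ?case by (auto intro: closed)
  next
    case empty
    then show ?case by (simp add: set_lebesgue_integral_def)
  next
    case (compl B)
    then have B: "B \<in> sets borel" by (simp add: borel_eq_closed)
    have "set_lebesgue_integral circle_measure (B \<union> (UNIV - B)) f
      = set_lebesgue_integral circle_measure B f + set_lebesgue_integral circle_measure (UNIV - B) f"
      by (intro set_integral_Un set_int) (use B in auto)
    then show ?case using compl UNIV by simp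
  next
    case (union A)
    then have A: "A i \<in> sets borel" for i by (auto simp: borel_eq_closed)
    have "set_lebesgue_integral circle_measure (\<Union>i. A i) f
      = (\<Sum>i. set_lebesgue_integral circle_measure (A i) f)"
      by (rule lebesgue_integral_countable_add)
         (use A union in \<open>auto intro!: set_int simp: disjoint_family_on_def\<close>)
    then show ?case using union by simp
  qed
qed

theorem fourier_zero_imp_AE_zero:
  assumes "integrable circle_measure f" "\<And>n. fourier f n = 0"
  shows "AE z in circle_measure. f z = 0"
  using assms by (intro circle.density_zero fourier_zero_set_integral) auto

section \<open>Square integrable functions on the circle\<close>

lemma borel_measurable_circle [simp]: "borel_measurable circle_measure = borel_measurable borel"
  by (rule measurable_cong_sets) auto

lemma measurable_cnj [measurable]: "cnj \<in> borel_measurable borel"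
  by (intro borel_measurable_continuous_onI continuous_intros)

lemma L2_iff: "f \<in> L2 \<longleftrightarrow> f \<in> borel_measurable borel \<and> integrable circle_measure (\<lambda>z. (norm (f z))\<^sup>2)"
  by (simp add: L2_def)

lemma L2_measurable: "f \<in> L2 \<Longrightarrow> f \<in> borel_measurable borel"
  by (simp add: L2_iff)

lemma L2_norm_nonneg [simp]: "L2_norm f \<ge> 0"
  by (simp add: L2_norm_def)

lemma L2_norm_power2: "(L2_norm f)\<^sup>2 = (\<integral>z. (norm (f z))\<^sup>2 \<partial>circle_measure)"
  by (simp add: L2_norm_def)

lemma L2_norm_power2_complex:
  "complex_of_real ((L2_norm f)\<^sup>2) = (\<integral>z. f z * cnj (f z) \<partial>circle_measure)"
  unfolding L2_norm_power2 integral_complex_of_real[symmetric] complex_norm_square ..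

text \<open>Cauchy-Schwarz is applied to nonnegative integrals, where no integrability has to be
  known; finiteness of the result then yields it.\<close>

lemma L2_integrable_norm_mult:
  assumes "f \<in> L2" "g \<in> L2"
  shows "integrable circle_measure (\<lambda>z. norm (f z) * norm (g z))"
    and "(\<integral>z. norm (f z) * norm (g z) \<partial>circle_measure) \<le> L2_norm f * L2_norm g"
proof -
  have [measurable]: "f \<in> borel_measurable borel" "g \<in> borel_measurable borel"
    using assms by (auto simp: L2_iff)
  have sq: "(\<integral>\<^sup>+z. (ennreal (norm (h z)))\<^sup>2 \<partial>circle_measure) = ennreal ((L2_norm h)\<^sup>2)" if "h \<in> L2" for h
    using that unfolding L2_norm_power2 L2_iff
    by (subst nn_integral_eq_integral[symmetric]) (auto simp: ennreal_power)
  have "(\<integral>\<^sup>+z. ennreal (norm (f z)) * ennreal (norm (g z)) \<partial>circle_measure)\<^sup>2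
      \<le> ennreal ((L2_norm f)\<^sup>2) * ennreal ((L2_norm g)\<^sup>2)"
    using Cauchy_Schwarz_nn_integral[of "\<lambda>z. ennreal (norm (f z))" circle_measure "\<lambda>z. ennreal (norm (g z))"]
    by (simp add: sq assms)
  also have "\<dots> = (ennreal (L2_norm f * L2_norm g))\<^sup>2"
    by (simp add: ennreal_mult' ennreal_power power_mult_distrib)
  finally have sq_le: "(\<integral>\<^sup>+z. ennreal (norm (f z) * norm (g z)) \<partial>circle_measure)\<^sup>2
      \<le> (ennreal (L2_norm f * L2_norm g))\<^sup>2"
    by (simp add: ennreal_mult')
  have le: "(\<integral>\<^sup>+z. ennreal (norm (f z) * norm (g z)) \<partial>circle_measure) \<le> ennreal (L2_norm f * L2_norm g)"
  proof (cases "\<integral>\<^sup>+z. ennreal (norm (f z) * norm (g z)) \<partial>circle_measure" rule: ennreal_cases)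
    case (real x)
    then have "x\<^sup>2 \<le> (L2_norm f * L2_norm g)\<^sup>2"
      using sq_le by (simp add: ennreal_power)
    then have "x \<le> L2_norm f * L2_norm g"
      by (rule power2_le_imp_le) simp
    then show ?thesis using real by (simp add: ennreal_leI)
  next
    case top
    then show ?thesis using sq_le by (simp add: ennreal_power top_unique)
  qed
  then show int: "integrable circle_measure (\<lambda>z. norm (f z) * norm (g z))"
    by (intro integrableI_bounded) (auto simp: norm_mult intro: le_less_trans)
  show "(\<integral>z. norm (f z) * norm (g z) \<partial>circle_measure) \<le> L2_norm f * L2_norm g"
    using le nn_integral_eq_integral[OF int] by (simp add: ennreal_le_iff)
qed

lemma L2_integrable_mult:
  assumes "f \<in> L2" "g \<in> L2"
  shows "integrable circle_measure (\<lambda>z. f z * g z)"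
  by (rule Bochner_Integration.integrable_bound[OF L2_integrable_norm_mult(1)[OF assms]])
     (use assms in \<open>auto simp: norm_mult L2_iff\<close>)

lemma L2_norm_integral_mult:
  assumes "f \<in> L2" "g \<in> L2"
  shows "norm (\<integral>z. f z * g z \<partial>circle_measure) \<le> L2_norm f * L2_norm g"
proof -
  have "norm (\<integral>z. f z * g z \<partial>circle_measure) \<le> (\<integral>z. norm (f z * g z) \<partial>circle_measure)"
    by (rule integral_norm_bound)
  also have "\<dots> \<le> L2_norm f * L2_norm g"
    using L2_integrable_norm_mult(2)[OF assms] by (simp add: norm_mult)
  finally show ?thesis .
qed

lemma L2_cmult: "f \<in> L2 \<Longrightarrow> (\<lambda>z. c * f z) \<in> L2"
  by (auto simp: L2_iff norm_mult power_mult_distrib)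

lemma L2_add:
  assumes "f \<in> L2" "g \<in> L2"
  shows "(\<lambda>z. f z + g z) \<in> L2"
proof -
  have "integrable circle_measure (\<lambda>z. (norm (f z + g z))\<^sup>2)"
  proof (rule Bochner_Integration.integrable_bound)
    show "integrable circle_measure (\<lambda>z. 2 * (norm (f z))\<^sup>2 + 2 * (norm (g z))\<^sup>2)"
      using assms by (auto simp: L2_iff)
    show "AE z in circle_measure. norm ((norm (f z + g z))\<^sup>2) \<le> norm (2 * (norm (f z))\<^sup>2 + 2 * (norm (g z))\<^sup>2)"
    proof (rule AE_I2)
      fix z
      have "(norm (f z + g z))\<^sup>2 \<le> (norm (f z) + norm (g z))\<^sup>2"
        by (intro power_mono norm_triangle_ineq) auto
      also have "\<dots> \<le> 2 * (norm (f z))\<^sup>2 + 2 * (norm (g z))\<^sup>2"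
        using zero_le_power2[of "norm (f z) - norm (g z)"] by (simp add: power2_eq_square algebra_simps)
      finally show "norm ((norm (f z + g z))\<^sup>2) \<le> norm (2 * (norm (f z))\<^sup>2 + 2 * (norm (g z))\<^sup>2)"
        by simp
    qed
  qed (use assms in \<open>auto simp: L2_iff\<close>)
  then show ?thesis using assms by (auto simp: L2_iff)
qed

lemma L2_diff: "f \<in> L2 \<Longrightarrow> g \<in> L2 \<Longrightarrow> (\<lambda>z. f z - g z) \<in> L2"
  using L2_add[of f "\<lambda>z. (-1) * g z"] L2_cmult[of g "-1"] by simp

lemma L2_cnj: "f \<in> L2 \<Longrightarrow> (\<lambda>z. cnj (f z)) \<in> L2"
  by (auto simp: L2_iff intro: measurable_compose[OF _ measurable_cnj])

lemma L2_norm_cnj [simp]: "L2_norm (\<lambda>z. cnj (f z)) = L2_norm f"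
  by (simp add: L2_norm_def)

lemma L2_mult_bounded:
  assumes "f \<in> L2" and b: "b \<in> borel_measurable borel" "AE z in circle_measure. norm (b z) \<le> B" "B \<ge> 0"
  shows "(\<lambda>z. b z * f z) \<in> L2" "L2_norm (\<lambda>z. b z * f z) \<le> B * L2_norm f"
proof -
  have le: "AE z in circle_measure. (norm (b z * f z))\<^sup>2 \<le> B\<^sup>2 * (norm (f z))\<^sup>2"
    using b(2)
  proof eventually_elim
    case (elim z)
    then have "norm (b z) * norm (f z) \<le> B * norm (f z)"
      by (intro mult_right_mono) auto
    then show ?case
      unfolding norm_mult power_mult_distrib[symmetric] by (intro power_mono) auto
  qed
  have int: "integrable circle_measure (\<lambda>z. B\<^sup>2 * (norm (f z))\<^sup>2)"
    using assms(1) by (auto simp: L2_iff)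
  have int': "integrable circle_measure (\<lambda>z. (norm (b z * f z))\<^sup>2)"
    by (rule Bochner_Integration.integrable_bound[OF int])
       (use le assms(1) b(1) in \<open>auto simp: L2_iff elim: eventually_mono\<close>)
  then show "(\<lambda>z. b z * f z) \<in> L2" using assms(1) b(1) by (auto simp: L2_iff)
  have "(L2_norm (\<lambda>z. b z * f z))\<^sup>2 \<le> (B * L2_norm f)\<^sup>2"
    using integral_mono_AE[OF int' int le] by (simp add: L2_norm_power2 power_mult_distrib)
  then show "L2_norm (\<lambda>z. b z * f z) \<le> B * L2_norm f"
    by (rule power2_le_imp_le) (use b(3) in simp)
qed

lemma L2_bounded:
  assumes b: "b \<in> borel_measurable borel" "AE z in circle_measure. norm (b z) \<le> B" "B \<ge> 0"
  shows "b \<in> L2"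
proof -
  have "(\<lambda>z. 1) \<in> L2" by (simp add: L2_iff)
  from L2_mult_bounded(1)[OF this b] show ?thesis by simp
qed

lemma L2_powi: "(\<lambda>z. z powi n) \<in> L2"
  by (rule L2_bounded[where B = 1]) (auto intro!: AE_circleI simp: norm_power_int)

lemma L2_integrable: "f \<in> L2 \<Longrightarrow> integrable circle_measure f"
  using L2_integrable_mult[of f "\<lambda>z. z powi 0"] L2_powi[of 0] by simp

lemma L2_norm_cong_AE:
  assumes "AE z in circle_measure. f z = g z" "f \<in> borel_measurable borel" "g \<in> borel_measurable borel"
  shows "L2_norm f = L2_norm g"
  unfolding L2_norm_def using assms
  by (intro arg_cong[where f = sqrt] integral_cong_AE) (auto elim: eventually_mono)

lemma fourier_cnj: "fourier (\<lambda>z. cnj (f z)) n = cnj (fourier f (- n))"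
  if "f \<in> borel_measurable borel"
proof -
  have "fourier (\<lambda>z. cnj (f z)) n = (\<integral>z. cnj (f z * z powi n) \<partial>circle_measure)"
    unfolding fourier_def
  proof (rule integral_cong_AE)
    show "AE z in circle_measure. cnj (f z) * z powi - n = cnj (f z * z powi n)"
      by (rule AE_circleI) (simp add: cnj_powi)
    note that[measurable]
    show "(\<lambda>z. cnj (f z) * z powi - n) \<in> borel_measurable circle_measure"
      "(\<lambda>z. cnj (f z * z powi n)) \<in> borel_measurable circle_measure"
      by measurable
  qed
  also have "\<dots> = cnj (fourier f (- n))"
    by (simp only: Bochner_Integration.integral_cnj fourier_def minus_minus)
  finally show ?thesis .
qed

section \<open>Trigonometric polynomials and the Riesz--Fischer theorem\<close>

text \<open>The frequencies form an arbitrary finite set rather than a symmetric interval, in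
  accordance with the unordered sums of \<open>summable_on\<close> and
  \<open>has_sum\<close>.\<close>

definition trig :: "int set \<Rightarrow> (int \<Rightarrow> complex) \<Rightarrow> circle_fun" where
  "trig F c z = (\<Sum>k\<in>F. c k * z powi k)"

lemma measurable_trig [measurable]: "trig F c \<in> borel_measurable borel"
  unfolding trig_def[abs_def] by measurable

lemma trig_bounded:
  "finite F \<Longrightarrow> AE z in circle_measure. norm (trig F c z) \<le> (\<Sum>k\<in>F. norm (c k))"
  unfolding trig_def
  by (rule AE_circleI) (auto intro!: sum_norm_le simp: norm_mult norm_power_int)

lemma L2_trig: "finite F \<Longrightarrow> trig F c \<in> L2"
  by (rule L2_bounded[OF measurable_trig trig_bounded]) (auto intro: sum_nonneg)

lemma fourier_trig_mult:
  assumes "finite F" "integrable circle_measure g"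
  shows "fourier (\<lambda>z. trig F c z * g z) n = (\<Sum>k\<in>F. c k * fourier g (n - k))"
proof -
  have "fourier (\<lambda>z. trig F c z * g z) n
      = (\<integral>z. (\<Sum>k\<in>F. c k * (z powi k * g z * z powi (-n))) \<partial>circle_measure)"
    unfolding fourier_def trig_def by (simp add: sum_distrib_right mult.assoc)
  also have "\<dots> = (\<Sum>k\<in>F. \<integral>z. c k * (z powi k * g z * z powi (-n)) \<partial>circle_measure)"
  proof (rule Bochner_Integration.integral_sum)
    fix k
    show "integrable circle_measure (\<lambda>z. c k * (z powi k * g z * z powi - n))"
      using integrable_powi_mult[OF integrable_powi_mult[OF assms(2), of k], of "-n"]
      by (intro integrable_mult_right) (simp add: mult_ac)
  qed
  also have "\<dots> = (\<Sum>k\<in>F. c k * fourier (\<lambda>z. z powi k * g z) n)"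
    by (simp add: fourier_def)
  finally show ?thesis by (simp add: fourier_mult_powi assms)
qed

lemma fourier_const: "fourier (\<lambda>z. 1) n = (if n = 0 then 1 else 0)"
  by (simp add: fourier_def integral_circle_power_int)

lemma fourier_trig:
  assumes "finite F"
  shows "fourier (trig F c) n = (if n \<in> F then c n else 0)"
proof -
  have "fourier (trig F c) n = (\<Sum>k\<in>F. c k * (if n - k = 0 then 1 else 0))"
    using fourier_trig_mult[OF assms, of "\<lambda>z. 1" c n] by (simp add: fourier_const)
  also have "\<dots> = (\<Sum>k\<in>F. if n = k then c k else 0)"
    by (intro sum.cong) auto
  finally show ?thesis using assms by simp
qed

lemma integral_mult_cnj_trig:
  assumes "finite F" "integrable circle_measure f"
  shows "(\<integral>z. f z * cnj (trig F c z) \<partial>circle_measure) = (\<Sum>k\<in>F. fourier f k * cnj (c k))"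
proof -
  have "(\<integral>z. f z * cnj (trig F c z) \<partial>circle_measure)
      = (\<integral>z. (\<Sum>k\<in>F. cnj (c k) * (f z * z powi (-k))) \<partial>circle_measure)"
  proof (rule integral_cong_AE)
    show "AE z in circle_measure. f z * cnj (trig F c z) = (\<Sum>k\<in>F. cnj (c k) * (f z * z powi - k))"
      by (rule AE_circleI) (simp add: trig_def sum_distrib_left cnj_powi mult_ac)
    have [measurable]: "f \<in> borel_measurable borel" using assms(2) by (simp flip: borel_measurable_circle)
    show "(\<lambda>z. f z * cnj (trig F c z)) \<in> borel_measurable circle_measure"
      "(\<lambda>z. \<Sum>k\<in>F. cnj (c k) * (f z * z powi - k)) \<in> borel_measurable circle_measure"
      by measurable
  qed
  also have "\<dots> = (\<Sum>k\<in>F. \<integral>z. cnj (c k) * (f z * z powi (-k)) \<partial>circle_measure)"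
    using integrable_powi_mult[OF assms(2)]
    by (intro Bochner_Integration.integral_sum integrable_mult_right) (simp add: mult.commute)
  finally show ?thesis by (simp add: fourier_def mult.commute)
qed

lemma L2_norm_trig:
  assumes "finite F"
  shows "(L2_norm (trig F c))\<^sup>2 = (\<Sum>k\<in>F. (norm (c k))\<^sup>2)"
proof -
  have "complex_of_real ((L2_norm (trig F c))\<^sup>2) = (\<Sum>k\<in>F. fourier (trig F c) k * cnj (c k))"
    unfolding L2_norm_power2_complex
    by (intro integral_mult_cnj_trig assms L2_integrable L2_trig)
  also have "\<dots> = complex_of_real (\<Sum>k\<in>F. (norm (c k))\<^sup>2)"
    unfolding of_real_sum complex_norm_square by (simp add: fourier_trig assms)
  finally show ?thesis by (simp only: of_real_eq_iff)
qed

text \<open>Pythagoras: the partial Fourier sum is the orthogonal projection, so both cross terms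
  equal its squared norm. Nonnegativity of the left side is Bessel's inequality.\<close>

lemma L2_norm_diff_trig:
  assumes "finite F" and f: "f \<in> L2"
  shows "(L2_norm (\<lambda>z. f z - trig F (fourier f) z))\<^sup>2
    = (L2_norm f)\<^sup>2 - (\<Sum>k\<in>F. (norm (fourier f k))\<^sup>2)"
proof -
  define p where "p = trig F (fourier f)"
  have p: "p \<in> L2" by (simp add: p_def L2_trig assms)
  have ip: "(\<integral>z. f z * cnj (p z) \<partial>circle_measure) = (\<Sum>k\<in>F. (norm (fourier f k))\<^sup>2)"
    unfolding p_def by (subst integral_mult_cnj_trig) (use assms L2_integrable complex_norm_square in auto)
  have pi: "(\<integral>z. p z * cnj (f z) \<partial>circle_measure) = (\<Sum>k\<in>F. (norm (fourier f k))\<^sup>2)"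
    using arg_cong[OF ip, of cnj] by (simp flip: Bochner_Integration.integral_cnj add: mult.commute)
  have pp: "(\<integral>z. p z * cnj (p z) \<partial>circle_measure) = (\<Sum>k\<in>F. (norm (fourier f k))\<^sup>2)"
    by (simp only: L2_norm_power2_complex[symmetric] p_def L2_norm_trig[OF assms(1)])
  note int = L2_integrable_mult[OF f L2_cnj[OF f]] L2_integrable_mult[OF f L2_cnj[OF p]]
    L2_integrable_mult[OF p L2_cnj[OF f]] L2_integrable_mult[OF p L2_cnj[OF p]]
  have "complex_of_real ((L2_norm (\<lambda>z. f z - p z))\<^sup>2)
    = (\<integral>z. (f z * cnj (f z) - f z * cnj (p z)) - (p z * cnj (f z) - p z * cnj (p z)) \<partial>circle_measure)"
    unfolding L2_norm_power2_complex by (simp add: algebra_simps)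
  also have "\<dots> = complex_of_real ((L2_norm f)\<^sup>2) - complex_of_real (\<Sum>k\<in>F. (norm (fourier f k))\<^sup>2)"
    by (simp only: Bochner_Integration.integral_diff Bochner_Integration.integrable_diff int ip pi pp L2_norm_power2_complex)
       simp
  finally show ?thesis
    by (simp only: p_def of_real_eq_iff flip: of_real_diff)
qed

lemma bessel:
  assumes "finite F" "f \<in> L2"
  shows "(\<Sum>k\<in>F. (norm (fourier f k))\<^sup>2) \<le> (L2_norm f)\<^sup>2"
  using L2_norm_diff_trig[OF assms] zero_le_power2[of "L2_norm (\<lambda>z. f z - trig F (fourier f) z)"]
  by linarith

lemma trig_Un_disjoint:
  "finite A \<Longrightarrow> finite B \<Longrightarrow> A \<inter> B = {} \<Longrightarrow> trig (A \<union> B) c z = trig A c z + trig B c z"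
  by (simp add: trig_def sum.union_disjoint)

text \<open>Each \<epsilon> j has a finite set that leaves at most this much of the sum; unions of
  these sets increase. The tail estimate applies in particular to the blocks between consecutive
  sets.\<close>

lemma summable_finite_exhaustion:
  fixes a :: "'a \<Rightarrow> real"
  assumes a: "a summable_on UNIV" "\<And>k. a k \<ge> 0" and \<epsilon>: "\<And>j. \<epsilon> j > 0"
  obtains G :: "nat \<Rightarrow> 'a set" where "\<And>j. finite (G j)" "\<And>j. G j \<subseteq> G (Suc j)"
    "\<And>j F. finite F \<Longrightarrow> F \<inter> G j = {} \<Longrightarrow> sum a F \<le> \<epsilon> j"
proof -
  have "\<exists>F. finite F \<and> infsum a UNIV - sum a F \<le> \<epsilon> j" for j
    using infsum_finite_approximation[OF a(1) \<epsilon>[of j]] by (force simp: dist_real_def)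
  then obtain H where H: "\<And>j. finite (H j)" "\<And>j. infsum a UNIV - sum a (H j) \<le> \<epsilon> j"
    by metis
  show ?thesis
  proof (rule that[of "\<lambda>j. \<Union>i\<le>j. H i"])
    fix j F assume F: "finite F" "F \<inter> (\<Union>i\<le>j. H i) = {}"
    then have "sum a F + sum a (H j) = sum a (F \<union> H j)"
      by (intro sum.union_disjoint[symmetric] H) auto
    also have "\<dots> \<le> infsum a UNIV"
      by (rule finite_sum_le_infsum) (use a F H in auto)
    finally show "sum a F \<le> \<epsilon> j" using H(2)[of j] by linarith
  qed (use H in \<open>auto simp: atMost_Suc\<close>)
qed

text \<open>Along finite sets with tails at most 4^-j the blocks have norm at most 2^-j, so the
  series of blocks converges absolutely almost everywhere and defines a pointwise limit. The norm
  bound, from Fatou, is kept in the conclusion because it is the second half of Parseval.\<close>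

theorem riesz_fischer:
  assumes c: "(\<lambda>n. (norm (c n))\<^sup>2) summable_on UNIV"
  obtains f where "f \<in> L2" "\<And>n. fourier f n = c n" "(L2_norm f)\<^sup>2 \<le> (\<Sum>\<^sub>\<infinity>n. (norm (c n))\<^sup>2)"
proof -
  define S where "S = (\<Sum>\<^sub>\<infinity>n. (norm (c n))\<^sup>2)"
  obtain G :: "nat \<Rightarrow> int set" where G: "\<And>j. finite (G j)" "\<And>j. G j \<subseteq> G (Suc j)"
    "\<And>j F. finite F \<Longrightarrow> F \<inter> G j = {} \<Longrightarrow> (\<Sum>n\<in>F. (norm (c n))\<^sup>2) \<le> (1 / 4) ^ j"
    by (rule summable_finite_exhaustion[OF c, of "\<lambda>j. (1 / 4) ^ j"]) auto
  \<comment> \<open>Telescoping blocks. The first is a whole partial sum, of uncontrolled size, so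
    the geometric bound concerns \<open>t (Suc j)\<close>, whose frequencies avoid
    \<open>G j\<close>.\<close>
  define t where "t = (\<lambda>j. case j of 0 \<Rightarrow> trig (G 0) c | Suc i \<Rightarrow> trig (G (Suc i) - G i) c)"
  have t_L2: "t j \<in> L2" for j
    using G(1) by (auto simp: t_def L2_trig split: nat.split)
  have partial: "(\<Sum>i<Suc j. t i z) = trig (G j) c z" for j z
  proof (induction j)
    case (Suc j)
    have "G (Suc j) = G j \<union> (G (Suc j) - G j)" using G(2) by blast
    then have "trig (G (Suc j)) c z = trig (G j) c z + trig (G (Suc j) - G j) c z"
      using trig_Un_disjoint[of "G j" "G (Suc j) - G j" c z] G(1) by auto
    then show ?case using Suc by (simp add: t_def)
  qed (simp add: t_def)
  have t_norm: "L2_norm (t (Suc j)) \<le> (1 / 2) ^ j" for j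
  proof (rule power2_le_imp_le)
    have "(L2_norm (t (Suc j)))\<^sup>2 \<le> (1 / 4) ^ j"
      unfolding t_def using G by (auto simp: L2_norm_trig intro!: G(3))
    then show "(L2_norm (t (Suc j)))\<^sup>2 \<le> ((1 / 2) ^ j)\<^sup>2"
      by (simp add: power_even_eq[symmetric] power_mult[symmetric] power_mult power2_eq_square flip: power_mult_distrib)
  qed simp
  have t_int: "integrable circle_measure (t j)" for j
    by (intro L2_integrable t_L2)
  \<comment> \<open>The measure has mass 1, so the constant function has norm 1 and the L1 norm is
    at most the \<open>L2\<close> norm.\<close>
  have one: "(\<lambda>z. 1) \<in> L2" "L2_norm (\<lambda>z. 1) = 1"
    by (auto simp: L2_iff L2_norm_def)
  have summable_int: "summable (\<lambda>j. \<integral>z. norm (t j z) \<partial>circle_measure)"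
  proof (rule summable_Suc_iff[THEN iffD1], rule summable_comparison_test')
    show "summable (\<lambda>j. (1 / 2 :: real) ^ j)" by (rule summable_geometric) auto
    fix j :: nat
    have "(\<integral>z. norm (t (Suc j) z) \<partial>circle_measure) \<le> L2_norm (t (Suc j))"
      using L2_integrable_norm_mult(2)[OF t_L2[of "Suc j"] one(1)] one(2) by simp
    then show "norm (\<integral>z. norm (t (Suc j) z) \<partial>circle_measure) \<le> (1 / 2) ^ j"
      using t_norm[of j] by simp
  qed
  have summable_AE: "AE z in circle_measure. summable (\<lambda>j. norm (t j z))"
  proof -
    have "(\<integral>\<^sup>+z. (\<Sum>j. ennreal (norm (t j z))) \<partial>circle_measure)
        = (\<Sum>j. \<integral>\<^sup>+z. ennreal (norm (t j z)) \<partial>circle_measure)"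
      using L2_measurable[OF t_L2] by (intro nn_integral_suminf) auto
    also have "\<dots> = (\<Sum>j. ennreal (\<integral>z. norm (t j z) \<partial>circle_measure))"
      using t_int by (subst nn_integral_eq_integral) auto
    also have "\<dots> \<noteq> \<infinity>"
      by (subst suminf_ennreal2[OF _ summable_int]) (simp_all del: suminf_ennreal2)
    finally have "AE z in circle_measure. (\<Sum>j. ennreal (norm (t j z))) \<noteq> \<infinity>"
      using L2_measurable[OF t_L2] by (intro nn_integral_noteq_infinite) auto
    then show ?thesis
      by eventually_elim (auto intro: summable_suminf_not_top)
  qed
  define f where "f = (\<lambda>z. \<Sum>j. t j z)"
  have f_int: "integrable circle_measure f"
    unfolding f_def by (rule integrable_suminf[OF t_int summable_AE summable_int])
  have f_meas [measurable]: "f \<in> borel_measurable borel"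
    using f_int by (simp flip: borel_measurable_circle)
  have trig_tendsto: "AE z in circle_measure. (\<lambda>j. trig (G j) c z) \<longlonglongrightarrow> f z"
    using summable_AE
  proof eventually_elim
    case (elim z)
    then have "(\<lambda>j. \<Sum>i<j. t i z) \<longlonglongrightarrow> f z"
      unfolding f_def by (rule summable_LIMSEQ[OF summable_norm_cancel])
    from LIMSEQ_Suc[OF this] show ?case unfolding partial .
  qed
  have fourier_f: "fourier f n = c n" for n
  proof -
    have "(\<lambda>j. \<integral>z. t j z * z powi (-n) \<partial>circle_measure) sums
        (\<integral>z. (\<Sum>j. t j z * z powi (-n)) \<partial>circle_measure)"
    proof (rule sums_integral)
      show "integrable circle_measure (\<lambda>z. t j z * z powi - n)" for j
        using integrable_powi_mult[OF t_int, of "-n"] by (simp add: mult.commute)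
      show "AE z in circle_measure. summable (\<lambda>j. norm (t j z * z powi - n))"
        using summable_AE by eventually_elim (auto simp: norm_mult intro: summable_mult2)
      have "(\<integral>z. norm (t j z * z powi - n) \<partial>circle_measure) = (\<integral>z. norm (t j z) \<partial>circle_measure)" for j
      proof (rule integral_cong_AE)
        note L2_measurable[OF t_L2[of j], measurable]
        show "(\<lambda>z. norm (t j z * z powi - n)) \<in> borel_measurable circle_measure"
          "(\<lambda>z. norm (t j z)) \<in> borel_measurable circle_measure" by measurable
        show "AE z in circle_measure. norm (t j z * z powi - n) = norm (t j z)"
          by (rule AE_circleI) (simp add: norm_mult norm_power_int)
      qed
      then show "summable (\<lambda>j. \<integral>z. norm (t j z * z powi - n) \<partial>circle_measure)"
        using summable_int by simp
    qed
    also have "(\<integral>z. (\<Sum>j. t j z * z powi (-n)) \<partial>circle_measure) = fourier f n"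
      unfolding fourier_def f_def
    proof (rule integral_cong_AE)
      show "AE z in circle_measure. (\<Sum>j. t j z * z powi - n) = (\<Sum>j. t j z) * z powi - n"
        using summable_AE by eventually_elim (simp add: suminf_mult2 summable_norm_cancel)
    qed (use L2_measurable[OF t_L2] in measurable)
    finally have "(\<lambda>j. fourier (t j) n) sums fourier f n" by (simp add: fourier_def)
    then have "(\<lambda>j. \<Sum>i<Suc j. fourier (t i) n) \<longlonglongrightarrow> fourier f n"
      unfolding sums_def by (rule LIMSEQ_Suc)
    moreover have "(\<Sum>i<Suc j. fourier (t i) n) = fourier (trig (G j) c) n" for j
    proof -
      have "(\<Sum>i<Suc j. fourier (t i) n) = (\<integral>z. (\<Sum>i<Suc j. t i z * z powi (-n)) \<partial>circle_measure)"
        unfolding fourier_def using integrable_powi_mult[OF t_int, of "-n"]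
        by (intro Bochner_Integration.integral_sum[symmetric]) (simp add: mult.commute)
      then show ?thesis
        by (simp only: fourier_def partial[symmetric] sum_distrib_right)
    qed
    ultimately have lim: "(\<lambda>j. fourier (trig (G j) c) n) \<longlonglongrightarrow> fourier f n" by simp
    \<comment> \<open>Outside \<open>G j\<close> the coefficient of the partial sum is 0 instead of
      \<open>c n\<close>, but then \<open>c n\<close> itself belongs to the tail.\<close>
    have "norm (fourier (trig (G j) c) n - c n) \<le> (1 / 2) ^ j" for j
    proof (rule power2_le_imp_le)
      have "(norm (c n))\<^sup>2 \<le> (1 / 4) ^ j" if "n \<notin> G j"
        using G(3)[of "{n}" j] that by simp
      then show "(norm (fourier (trig (G j) c) n - c n))\<^sup>2 \<le> ((1 / 2) ^ j)\<^sup>2"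
        using G(1) by (auto simp: fourier_trig power2_eq_square simp flip: power_mult_distrib)
    qed simp
    then have "\<forall>\<^sub>F j in sequentially. norm (fourier (trig (G j) c) n - c n) \<le> (1 / 2) ^ j"
      by (intro always_eventually allI)
    moreover have "(\<lambda>j. (1 / 2 :: real) ^ j) \<longlonglongrightarrow> 0"
      by (rule LIMSEQ_power_zero) simp
    ultimately have "(\<lambda>j. fourier (trig (G j) c) n - c n) \<longlonglongrightarrow> 0"
      by (rule Lim_null_comparison)
    then have "(\<lambda>j. fourier (trig (G j) c) n) \<longlonglongrightarrow> c n"
      by (rule LIM_zero_cancel)
    with lim show ?thesis by (rule LIMSEQ_unique)
  qed
  have "(\<integral>\<^sup>+z. ennreal ((norm (f z))\<^sup>2) \<partial>circle_measure)
      = (\<integral>\<^sup>+z. liminf (\<lambda>j. ennreal ((norm (trig (G j) c z))\<^sup>2)) \<partial>circle_measure)"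
  proof (rule nn_integral_cong_AE)
    show "AE z in circle_measure. ennreal ((norm (f z))\<^sup>2) = liminf (\<lambda>j. ennreal ((norm (trig (G j) c z))\<^sup>2))"
      using trig_tendsto
    proof eventually_elim
      case (elim z)
      then have "(\<lambda>j. ennreal ((norm (trig (G j) c z))\<^sup>2)) \<longlonglongrightarrow> ennreal ((norm (f z))\<^sup>2)"
        by (intro tendsto_intros)
      then show ?case by (intro lim_imp_Liminf[symmetric] sequentially_bot)
    qed
  qed
  also have "\<dots> \<le> liminf (\<lambda>j. \<integral>\<^sup>+z. ennreal ((norm (trig (G j) c z))\<^sup>2) \<partial>circle_measure)"
    by (rule nn_integral_liminf) measurable
  also have "\<dots> \<le> ennreal S"
  proof (rule Liminf_le)
    show "\<forall>\<^sub>F j in sequentially. (\<integral>\<^sup>+z. ennreal ((norm (trig (G j) c z))\<^sup>2) \<partial>circle_measure) \<le> ennreal S"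
    proof (rule always_eventually, rule allI)
      fix j
      have "(\<integral>\<^sup>+z. ennreal ((norm (trig (G j) c z))\<^sup>2) \<partial>circle_measure) = ennreal ((L2_norm (trig (G j) c))\<^sup>2)"
        using L2_trig[OF G(1), of j c] unfolding L2_norm_power2 L2_iff by (intro nn_integral_eq_integral) auto
      also have "\<dots> \<le> ennreal S"
        unfolding L2_norm_trig[OF G(1)] S_def
        by (intro ennreal_leI finite_sum_le_infsum c G) auto
      finally show "(\<integral>\<^sup>+z. ennreal ((norm (trig (G j) c z))\<^sup>2) \<partial>circle_measure) \<le> ennreal S" .
    qed
  qed auto
  finally have fatou: "(\<integral>\<^sup>+z. ennreal ((norm (f z))\<^sup>2) \<partial>circle_measure) \<le> ennreal S" .
  then have f: "f \<in> L2"
    unfolding L2_iff by (auto intro!: integrableI_bounded le_less_trans[OF fatou])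
  have "S \<ge> 0" unfolding S_def by (rule infsum_nonneg) auto
  then have "(L2_norm f)\<^sup>2 \<le> S"
    using fatou f nn_integral_eq_integral[of circle_measure "\<lambda>z. (norm (f z))\<^sup>2"]
    by (simp add: L2_iff L2_norm_power2)
  with f fourier_f show ?thesis by (intro that[of f]) (auto simp: S_def)
qed

lemma fourier_eq_imp_AE_eq:
  assumes "f \<in> L2" "g \<in> L2" "\<And>n. fourier f n = fourier g n"
  shows "AE z in circle_measure. f z = g z"
proof -
  have "AE z in circle_measure. f z - g z = 0"
    using assms by (intro fourier_zero_imp_AE_zero) (auto intro!: L2_integrable L2_diff simp: fourier_diff L2_integrable)
  then show ?thesis by simp
qed

lemma fourier_summable: "f \<in> L2 \<Longrightarrow> (\<lambda>n. (norm (fourier f n))\<^sup>2) summable_on UNIV"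
  by (rule nonneg_bdd_above_summable_on) (auto intro!: bdd_aboveI[of _ "(L2_norm f)\<^sup>2"] bessel)

text \<open>The function built by Riesz-Fischer from the coefficients of \<open>f\<close> agrees
  with \<open>f\<close> almost everywhere; its norm bound is the inequality opposite to
  Bessel's.\<close>

theorem parseval:
  assumes f: "f \<in> L2"
  shows "((\<lambda>n. (norm (fourier f n))\<^sup>2) has_sum (L2_norm f)\<^sup>2) UNIV"
proof -
  obtain g where g: "g \<in> L2" "\<And>n. fourier g n = fourier f n"
    "(L2_norm g)\<^sup>2 \<le> (\<Sum>\<^sub>\<infinity>n. (norm (fourier f n))\<^sup>2)"
    using riesz_fischer[OF fourier_summable[OF f]] by blast
  have "L2_norm f = L2_norm g"
    using f g(1,2) by (intro L2_norm_cong_AE fourier_eq_imp_AE_eq) (auto simp: L2_iff)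
  moreover have "(\<Sum>\<^sub>\<infinity>n. (norm (fourier f n))\<^sup>2) \<le> (L2_norm f)\<^sup>2"
    by (intro infsum_le_finite_sums fourier_summable bessel f)
  ultimately show ?thesis
    using g(3) fourier_summable[OF f] by (simp add: has_sum_iff)
qed

section \<open>Density of trigonometric polynomials and spectra of products\<close>

lemma L2_trig_approximation:
  assumes f: "f \<in> L2" and "e > 0"
  obtains F where "finite F" "L2_norm (\<lambda>z. f z - trig F (fourier f) z) \<le> e"
proof -
  obtain F where F: "finite F" "dist (\<Sum>n\<in>F. (norm (fourier f n))\<^sup>2) ((L2_norm f)\<^sup>2) \<le> e\<^sup>2"
    using has_sum_finite_approximation[OF parseval[OF f], of "e\<^sup>2"] \<open>e > 0\<close> by auto
  have "(L2_norm (\<lambda>z. f z - trig F (fourier f) z))\<^sup>2 \<le> e\<^sup>2"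
    using F(2) by (simp add: L2_norm_diff_trig[OF F(1) f] dist_real_def)
  then have "L2_norm (\<lambda>z. f z - trig F (fourier f) z) \<le> e"
    by (rule power2_le_imp_le) (use \<open>e > 0\<close> in simp)
  with F(1) show ?thesis by (rule that)
qed

text \<open>Frequencies add under multiplication. As the product is merely integrable,
  \<open>f\<close> is approximated by its own partial sums, which keep its spectrum, and
  Cauchy-Schwarz handles the error. Together with its mirror image this is the tool behind every
  later argument with spectra.\<close>

lemma fourier_mult_eq_0:
  assumes f: "f \<in> L2" and g: "g \<in> L2"
    and a: "\<And>k. k < a \<Longrightarrow> fourier f k = 0" and b: "\<And>k. k < b \<Longrightarrow> fourier g k = 0" and n: "n < a + b"
  shows "fourier (\<lambda>z. f z * g z) n = 0"
proof -
  have "norm (fourier (\<lambda>z. f z * g z) n) \<le> 0 + e" if "e > 0" for e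
  proof -
    define d where "d = e / (L2_norm g + 1)"
    have "L2_norm g + 1 > 0" using L2_norm_nonneg[of g] by linarith
    then have d: "d > 0" "d * L2_norm g \<le> e"
      using that by (auto simp: d_def field_simps)
    obtain F where F: "finite F" "L2_norm (\<lambda>z. f z - trig F (fourier f) z) \<le> d"
      using L2_trig_approximation[OF f d(1)] .
    have r: "(\<lambda>z. f z - trig F (fourier f) z) \<in> L2"
      by (intro L2_diff f L2_trig F)
    have "fourier (\<lambda>z. trig F (fourier f) z * g z) n = 0"
      unfolding fourier_trig_mult[OF F(1) L2_integrable[OF g]]
    proof (rule sum.neutral, rule ballI)
      fix k
      have "k < a \<or> n - k < b" using n by linarith
      then show "fourier f k * fourier g (n - k) = 0" using a b by auto
    qed
    moreover have "fourier (\<lambda>z. f z * g z) n =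
      fourier (\<lambda>z. (f z - trig F (fourier f) z) * g z + trig F (fourier f) z * g z) n"
      by (simp add: algebra_simps)
    ultimately have "fourier (\<lambda>z. f z * g z) n = fourier (\<lambda>z. (f z - trig F (fourier f) z) * g z) n"
      by (simp add: fourier_add L2_integrable_mult r g L2_trig F)
    also have "norm \<dots> = norm (\<integral>z. (f z - trig F (fourier f) z) * (z powi (-n) * g z) \<partial>circle_measure)"
      by (simp add: fourier_def mult_ac)
    also have "\<dots> \<le> L2_norm (\<lambda>z. f z - trig F (fourier f) z) * L2_norm (\<lambda>z. z powi (-n) * g z)"
      by (intro L2_norm_integral_mult r L2_mult_bounded(1)[where B = 1] g) (auto intro!: AE_circleI simp: norm_power_int)
    also have "\<dots> \<le> d * (1 * L2_norm g)"
      using d F by (intro mult_mono L2_mult_bounded(2) g) (auto intro!: AE_circleI simp: norm_power_int)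
    finally show ?thesis using d by simp
  qed
  then have "norm (fourier (\<lambda>z. f z * g z) n) \<le> 0"
    by (rule field_le_epsilon)
  then show ?thesis by simp
qed

section \<open>Essentially bounded functions\<close>

text \<open>A quantitative L-infinity bound in place of an essential supremum. Measurability and 0
  \<le> B are included so that the predicate alone makes \<open>f\<close> a multiplier of
  \<open>L2\<close>.\<close>

definition ess_bounded :: "real \<Rightarrow> circle_fun \<Rightarrow> bool" where
  "ess_bounded B f \<longleftrightarrow> f \<in> borel_measurable borel \<and> 0 \<le> B \<and> (AE z in circle_measure. norm (f z) \<le> B)"

lemma ess_bounded_measurable: "ess_bounded B f \<Longrightarrow> f \<in> borel_measurable borel"
  by (simp add: ess_bounded_def)

lemma ess_bounded_nonneg: "ess_bounded B f \<Longrightarrow> 0 \<le> B"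
  by (simp add: ess_bounded_def)

lemma ess_bounded_L2: "ess_bounded B f \<Longrightarrow> f \<in> L2"
  by (auto simp: ess_bounded_def intro: L2_bounded)

lemma L2_mult_ess_bounded: "ess_bounded B b \<Longrightarrow> f \<in> L2 \<Longrightarrow> (\<lambda>z. b z * f z) \<in> L2"
  by (auto simp: ess_bounded_def intro: L2_mult_bounded)

lemma L2_norm_mult_ess_bounded: "ess_bounded B b \<Longrightarrow> f \<in> L2 \<Longrightarrow> L2_norm (\<lambda>z. b z * f z) \<le> B * L2_norm f"
  by (auto simp: ess_bounded_def intro: L2_mult_bounded)

lemma ess_bounded_mono: "ess_bounded B f \<Longrightarrow> B \<le> C \<Longrightarrow> ess_bounded C f"
  by (auto simp: ess_bounded_def elim: eventually_mono)

lemma ess_bounded_cong_AE: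
  "ess_bounded B f \<Longrightarrow> g \<in> borel_measurable borel \<Longrightarrow> AE z in circle_measure. f z = g z \<Longrightarrow> ess_bounded B g"
  unfolding ess_bounded_def by (auto elim: eventually_elim2)

lemma ess_bounded_add:
  assumes "ess_bounded B f" "ess_bounded C g"
  shows "ess_bounded (B + C) (\<lambda>z. f z + g z)"
proof -
  have "AE z in circle_measure. norm (f z) \<le> B" "AE z in circle_measure. norm (g z) \<le> C"
    using assms by (auto simp: ess_bounded_def)
  then have "AE z in circle_measure. norm (f z + g z) \<le> B + C"
    by eventually_elim (rule norm_triangle_mono)
  then show ?thesis using assms by (auto simp: ess_bounded_def)
qed

lemma ess_bounded_mult:
  assumes "ess_bounded B f" "ess_bounded C g"
  shows "ess_bounded (B * C) (\<lambda>z. f z * g z)"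
proof -
  have "AE z in circle_measure. norm (f z) \<le> B" "AE z in circle_measure. norm (g z) \<le> C"
    using assms by (auto simp: ess_bounded_def)
  then have "AE z in circle_measure. norm (f z * g z) \<le> B * C"
    by eventually_elim (auto simp: norm_mult intro: mult_mono ess_bounded_nonneg[OF assms(1)])
  then show ?thesis using assms by (auto simp: ess_bounded_def)
qed

lemma ess_bounded_cmult:
  assumes "ess_bounded B f"
  shows "ess_bounded (norm c * B) (\<lambda>z. c * f z)"
proof -
  have "ess_bounded (norm c) (\<lambda>z. c)" by (simp add: ess_bounded_def)
  from ess_bounded_mult[OF this assms] show ?thesis .
qed

lemma ess_bounded_diff:
  "ess_bounded B f \<Longrightarrow> ess_bounded C g \<Longrightarrow> ess_bounded (B + C) (\<lambda>z. f z - g z)"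
  using ess_bounded_add[of B f C "\<lambda>z. - 1 * g z"] ess_bounded_cmult[of C g "- 1"] by simp

lemma ess_bounded_cnj: "ess_bounded B f \<Longrightarrow> ess_bounded B (\<lambda>z. cnj (f z))"
  by (auto simp: ess_bounded_def intro: measurable_compose[OF _ measurable_cnj])

lemma abs_sq_eq_mult_cnj: "abs_sq f z = f z * cnj (f z)"
  unfolding abs_sq_def complex_norm_square ..

lemma ess_bounded_abs_sq: "ess_bounded B f \<Longrightarrow> ess_bounded (B * B) (abs_sq f)"
  using ess_bounded_mult[OF _ ess_bounded_cnj, of B f B f] by (simp add: abs_sq_eq_mult_cnj[abs_def])

lemma divide_eq_powi: "f z / z = z powi (- 1) * f z" for z :: complex
  by (simp add: power_int_minus field_simps)

lemma ess_bounded_divide: "ess_bounded B f \<Longrightarrow> ess_bounded B (\<lambda>z. f z / z)"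
proof -
  assume "ess_bounded B f"
  moreover have "ess_bounded 1 (\<lambda>z. z powi (-1))"
    by (auto simp: ess_bounded_def norm_power_int norm_inverse intro!: AE_circleI)
  ultimately show "ess_bounded B (\<lambda>z. f z / z)"
    using ess_bounded_mult[of 1 "\<lambda>z. z powi (-1)" B f] by (simp add: divide_eq_powi)
qed

lemma fourier_divide: "f \<in> L2 \<Longrightarrow> fourier (\<lambda>z. f z / z) n = fourier f (n + 1)"
  by (simp only: divide_eq_powi fourier_mult_powi L2_integrable) simp

section \<open>The Szego projector\<close>

text \<open>Conjugation reverses spectra and reduces this to
  \<open>fourier_mult_eq_0\<close>.\<close>

lemma fourier_mult_eq_0':
  assumes f: "f \<in> L2" and g: "g \<in> L2"
    and a: "\<And>k. k > a \<Longrightarrow> fourier f k = 0" and b: "\<And>k. k > b \<Longrightarrow> fourier g k = 0" and n: "n > a + b"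
  shows "fourier (\<lambda>z. f z * g z) n = 0"
proof -
  have "fourier (\<lambda>z. cnj (f z) * cnj (g z)) (- n) = 0"
    by (rule fourier_mult_eq_0[where a = "- a" and b = "- b"])
       (use assms in \<open>auto simp: fourier_cnj L2_measurable L2_cnj\<close>)
  moreover have "fourier (\<lambda>z. cnj (f z * g z)) (- n) = cnj (fourier (\<lambda>z. f z * g z) n)"
    using L2_measurable[OF f] L2_measurable[OF g] by (subst fourier_cnj) auto
  ultimately show ?thesis by simp
qed

lemma summable_projection:
  fixes c :: "int \<Rightarrow> complex"
  assumes "(\<lambda>n. (norm (c n))\<^sup>2) summable_on UNIV" "\<And>n. norm (d n) \<le> norm (c n)"
  shows "(\<lambda>n. (norm (d n))\<^sup>2) summable_on UNIV"
proof -
  have "(\<lambda>n. norm ((norm (d n))\<^sup>2)) summable_on UNIV"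
  proof (rule Infinite_Sum.abs_summable_on_comparison_test')
    show "(\<lambda>n. (norm (c n))\<^sup>2) summable_on UNIV" by (rule assms(1))
  qed (use assms(2) in \<open>auto intro: power_mono\<close>)
  then show ?thesis by simp
qed

lemma fourier_synth:
  assumes "(\<lambda>n. (norm (c n))\<^sup>2) summable_on UNIV"
  shows "fourier_synth c \<in> L2" "fourier (fourier_synth c) n = c n"
proof -
  have "\<exists>f. f \<in> L2 \<and> (\<forall>n. fourier f n = c n)"
    using riesz_fischer[OF assms] by metis
  from someI_ex[OF this] show "fourier_synth c \<in> L2" "fourier (fourier_synth c) n = c n"
    by (auto simp: fourier_synth_def)
qed

lemma L2_plusD: "f \<in> L2_plus \<Longrightarrow> f \<in> L2" "f \<in> L2_plus \<Longrightarrow> n < 0 \<Longrightarrow> fourier f n = 0"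
  by (auto simp: L2_plus_def)

context
  fixes f assumes f: "f \<in> L2"
begin

lemma szego_summable: "(\<lambda>n. (norm (if n \<ge> 0 then fourier f n else 0))\<^sup>2) summable_on UNIV"
  by (rule summable_projection[OF fourier_summable[OF f]]) auto

lemma L2_szego: "szego f \<in> L2"
  unfolding szego_def by (rule fourier_synth(1)[OF szego_summable])

lemma fourier_szego: "fourier (szego f) n = (if n \<ge> 0 then fourier f n else 0)"
  unfolding szego_def by (rule fourier_synth(2)[OF szego_summable])

lemma szego_L2_plus: "szego f \<in> L2_plus"
  by (simp add: L2_plus_def L2_szego fourier_szego)

lemma L2_norm_szego_le: "L2_norm (szego f) \<le> L2_norm f"
proof (rule power2_le_imp_le)
  show "(L2_norm (szego f))\<^sup>2 \<le> (L2_norm f)\<^sup>2"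
    by (rule has_sum_mono[OF parseval[OF L2_szego] parseval[OF f]]) (auto simp: fourier_szego)
qed simp

lemma shift_adj_summable: "(\<lambda>n. (norm (if n \<ge> 0 then fourier f (n + 1) else 0))\<^sup>2) summable_on UNIV"
proof (rule summable_projection)
  show "(\<lambda>n. (norm (fourier f (n + 1)))\<^sup>2) summable_on UNIV"
    using fourier_summable[OF f] summable_on_reindex_bij_betw[of "\<lambda>n. n + 1" UNIV UNIV "\<lambda>n. (norm (fourier f n))\<^sup>2"]
    by (simp add: bij_plus_right)
qed auto

lemma L2_shift_adj: "shift_adj f \<in> L2"
  unfolding shift_adj_def by (rule fourier_synth(1)[OF shift_adj_summable])

lemma fourier_shift_adj: "fourier (shift_adj f) n = (if n \<ge> 0 then fourier f (n + 1) else 0)"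
  unfolding shift_adj_def by (rule fourier_synth(2)[OF shift_adj_summable])

text \<open>What \<open>szego\<close> removes has frequencies at most -1 and the conjugate of
  \<open>g\<close> has frequencies at most 0, so their product has mean zero: \<open>szego\<close>
  is the orthogonal projection. This lets norms of Hankel images be computed by pairing.\<close>

lemma integral_szego_mult_cnj:
  assumes g: "g \<in> L2_plus"
  shows "(\<integral>z. szego f z * cnj (g z) \<partial>circle_measure) = (\<integral>z. f z * cnj (g z) \<partial>circle_measure)"
proof -
  have gc: "(\<lambda>z. cnj (g z)) \<in> L2" using g by (intro L2_cnj L2_plusD)
  have "fourier (\<lambda>z. (f z - szego f z) * cnj (g z)) 0 = 0"
    by (rule fourier_mult_eq_0'[where a = "- 1" and b = 0])
       (use f g gc L2_szego in \<open>auto intro: L2_diff simp: fourier_diff L2_integrable fourier_szego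
          fourier_cnj L2_plusD L2_measurable\<close>)
  then show ?thesis
    by (simp add: fourier_def left_diff_distrib L2_integrable_mult f gc L2_szego)
qed

end

text \<open>An equality of functions, not only almost everywhere: the choice in
  \<open>fourier_synth\<close> depends on the coefficient sequence alone.\<close>

lemma szego_cong: "(\<And>n. n \<ge> 0 \<Longrightarrow> fourier f n = fourier g n) \<Longrightarrow> szego f = szego g"
  unfolding szego_def by (intro arg_cong[where f = fourier_synth] ext) auto

lemma L2_plus_add: "f \<in> L2_plus \<Longrightarrow> g \<in> L2_plus \<Longrightarrow> (\<lambda>z. f z + g z) \<in> L2_plus"
  by (auto simp: L2_plus_def L2_add fourier_add L2_integrable)

lemma L2_plus_diff: "f \<in> L2_plus \<Longrightarrow> g \<in> L2_plus \<Longrightarrow> (\<lambda>z. f z - g z) \<in> L2_plus"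
  by (auto simp: L2_plus_def L2_diff fourier_diff L2_integrable)

lemma L2_plus_cmult: "f \<in> L2_plus \<Longrightarrow> (\<lambda>z. c * f z) \<in> L2_plus"
  by (auto simp: L2_plus_def L2_cmult fourier_cmult)

lemma L2_plus_eqI:
  assumes "f \<in> L2_plus" "g \<in> L2_plus" "\<And>n. n \<ge> 0 \<Longrightarrow> fourier f n = fourier g n"
  shows "AE z in circle_measure. f z = g z"
  using assms by (intro fourier_eq_imp_AE_eq) (auto simp: L2_plus_def, metis not_le)

section \<open>Hankel and Toeplitz operators with bounded symbols\<close>

lemma L2_mult_cnj: "ess_bounded B w \<Longrightarrow> h \<in> L2 \<Longrightarrow> (\<lambda>z. w z * cnj (h z)) \<in> L2"
  by (intro L2_mult_ess_bounded L2_cnj)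

lemma hankel_L2_plus: "ess_bounded B w \<Longrightarrow> h \<in> L2 \<Longrightarrow> hankel w h \<in> L2_plus"
  unfolding hankel_def by (intro szego_L2_plus L2_mult_cnj)

lemma toeplitz_L2_plus: "ess_bounded B b \<Longrightarrow> h \<in> L2 \<Longrightarrow> toeplitz b h \<in> L2_plus"
  unfolding toeplitz_def by (intro szego_L2_plus L2_mult_ess_bounded)

lemma fourier_hankel:
  "ess_bounded B w \<Longrightarrow> h \<in> L2 \<Longrightarrow> n \<ge> 0 \<Longrightarrow> fourier (hankel w h) n = fourier (\<lambda>z. w z * cnj (h z)) n"
  unfolding hankel_def by (simp add: fourier_szego L2_mult_cnj)

lemma fourier_toeplitz:
  "ess_bounded B b \<Longrightarrow> h \<in> L2 \<Longrightarrow> n \<ge> 0 \<Longrightarrow> fourier (toeplitz b h) n = fourier (\<lambda>z. b z * h z) n"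
  unfolding toeplitz_def by (simp add: fourier_szego L2_mult_ess_bounded)

lemma L2_norm_hankel_le:
  assumes "ess_bounded B w" "h \<in> L2"
  shows "L2_norm (hankel w h) \<le> B * L2_norm h"
proof -
  have "L2_norm (hankel w h) \<le> L2_norm (\<lambda>z. w z * cnj (h z))"
    unfolding hankel_def by (rule L2_norm_szego_le[OF L2_mult_cnj[OF assms]])
  also have "\<dots> \<le> B * L2_norm h"
    using L2_norm_mult_ess_bounded[OF assms(1) L2_cnj[OF assms(2)]] by simp
  finally show ?thesis .
qed

lemma bounded_real_linear_hankel:
  assumes w: "ess_bounded B w"
  shows "bounded_real_linear_op (hankel w)"
  unfolding bounded_real_linear_op_def
proof (intro conjI ballI allI exI)
  fix f g assume f: "f \<in> L2_plus" and g: "g \<in> L2_plus"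
  note fg = L2_plusD(1)[OF f] L2_plusD(1)[OF g]
  show "AE z in circle_measure. hankel w (\<lambda>z. f z + g z) z = hankel w f z + hankel w g z"
  proof (rule L2_plus_eqI)
    fix n :: int assume "n \<ge> 0"
    then show "fourier (hankel w (\<lambda>z. f z + g z)) n = fourier (\<lambda>z. hankel w f z + hankel w g z) n"
      by (simp add: fourier_hankel[OF w] fg L2_add fourier_add L2_integrable L2_plusD hankel_L2_plus[OF w]
          L2_mult_cnj[OF w] distrib_left)
  qed (intro hankel_L2_plus[OF w] L2_plus_add L2_add fg)+
next
  fix c :: real and f assume f: "f \<in> L2_plus"
  note f = L2_plusD(1)[OF f]
  show "AE z in circle_measure. hankel w (\<lambda>z. complex_of_real c * f z) z = complex_of_real c * hankel w f z"
  proof (rule L2_plus_eqI)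
    fix n :: int assume "n \<ge> 0"
    moreover have "fourier (\<lambda>z. w z * (complex_of_real c * cnj (f z))) n
      = complex_of_real c * fourier (\<lambda>z. w z * cnj (f z)) n"
      using fourier_cmult[of "complex_of_real c" "\<lambda>z. w z * cnj (f z)" n] by (simp add: mult.left_commute)
    ultimately show "fourier (hankel w (\<lambda>z. complex_of_real c * f z)) n
        = fourier (\<lambda>z. complex_of_real c * hankel w f z) n"
      by (simp add: fourier_hankel[OF w] f L2_cmult fourier_cmult)
  qed (intro hankel_L2_plus[OF w] L2_plus_cmult L2_cmult f)+
next
  fix f assume "f \<in> L2_plus"
  then show "hankel w f \<in> L2_plus" "L2_norm (hankel w f) \<le> B * L2_norm f"
    by (auto intro: hankel_L2_plus[OF w] L2_norm_hankel_le[OF w] L2_plusD)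
qed

lemma bounded_real_linear_op_cong_AE:
  assumes A: "bounded_real_linear_op A" and A': "\<And>h. h \<in> L2_plus \<Longrightarrow> A' h \<in> L2_plus"
    and eq: "\<And>h. h \<in> L2_plus \<Longrightarrow> AE z in circle_measure. A' h z = A h z"
  shows "bounded_real_linear_op A'"
  unfolding bounded_real_linear_op_def
proof (intro conjI ballI allI)
  note A = A[unfolded bounded_real_linear_op_def]
  fix f g assume fg: "f \<in> L2_plus" "g \<in> L2_plus"
  have "AE z in circle_measure. A (\<lambda>z. f z + g z) z = A f z + A g z" using A fg by blast
  then show "AE z in circle_measure. A' (\<lambda>z. f z + g z) z = A' f z + A' g z"
    using eq[OF fg(1)] eq[OF fg(2)] eq[OF L2_plus_add[OF fg]] by eventually_elim simp
next
  note A = A[unfolded bounded_real_linear_op_def]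
  fix c f assume f: "f \<in> L2_plus"
  have "AE z in circle_measure. A (\<lambda>z. complex_of_real c * f z) z = complex_of_real c * A f z" using A f by blast
  then show "AE z in circle_measure. A' (\<lambda>z. complex_of_real c * f z) z = complex_of_real c * A' f z"
    using eq[OF f] eq[OF L2_plus_cmult[OF f, of "complex_of_real c"]] by eventually_elim simp
next
  note A = A[unfolded bounded_real_linear_op_def]
  then obtain C where C: "\<And>f. f \<in> L2_plus \<Longrightarrow> L2_norm (A f) \<le> C * L2_norm f" by blast
  have "L2_norm (A' f) = L2_norm (A f)" if "f \<in> L2_plus" for f
    using A that by (intro L2_norm_cong_AE eq A' L2_measurable L2_plusD) auto
  then show "\<exists>C. \<forall>f\<in>L2_plus. L2_norm (A' f) \<le> C * L2_norm f"
    using C by auto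
qed (rule A')

text \<open>With \<open>g = w h\<^sup>* - hankel w h\<close>, the function \<open>w g\<^sup>*\<close> has no negative frequencies, so
  \<open>\<bar>w\<bar>\<^sup>2 g = w (w g\<^sup>*)\<^sup>*\<close> can be expressed by the operators again. One negative frequency of \<open>w\<close>
  is affordable because \<open>g\<^sup>*\<close> starts at frequency 1.\<close>

lemma fourier_cubic_hankel:
  assumes w: "ess_bounded B w" "\<And>k. k < - 1 \<Longrightarrow> fourier w k = 0" and h: "h \<in> L2"
  shows "fourier (\<lambda>z. abs_sq w z * w z * cnj (h z)) n =
    fourier (\<lambda>z. abs_sq w z * hankel w h z) n
    + fourier (\<lambda>z. w z * cnj (toeplitz (abs_sq w) h z)) n
    - fourier (\<lambda>z. w z * cnj (hankel w (hankel w h) z)) n"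
proof -
  define g where "g = (\<lambda>z. w z * cnj (h z) - hankel w h z)"
  define p where "p = (\<lambda>z. abs_sq w z * h z - w z * cnj (hankel w h z))"
  define T where "T = toeplitz (abs_sq w) h"
  define JJ where "JJ = hankel w (hankel w h)"
  have w2: "ess_bounded (B * B) (abs_sq w)" by (rule ess_bounded_abs_sq[OF w(1)])
  have J: "hankel w h \<in> L2_plus" by (rule hankel_L2_plus[OF w(1) h])
  have JJ: "JJ \<in> L2_plus" unfolding JJ_def by (intro hankel_L2_plus[OF w(1)] L2_plusD J)
  have T: "T \<in> L2_plus" unfolding T_def by (rule toeplitz_L2_plus[OF w2 h])
  have g: "g \<in> L2" unfolding g_def by (intro L2_diff L2_mult_cnj[OF w(1)] h L2_plusD(1)[OF J])
  have g_neg: "fourier g k = 0" if "k \<ge> 0" for k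
    using that unfolding g_def
    by (simp add: fourier_diff L2_integrable L2_mult_cnj[OF w(1)] h L2_plusD(1)[OF J] fourier_hankel[OF w(1) h])
  have p_eq: "p z = w z * cnj (g z)" for z
    by (simp add: p_def g_def abs_sq_eq_mult_cnj algebra_simps)
  have p: "p \<in> L2" unfolding p_eq[abs_def] by (rule L2_mult_cnj[OF w(1) g])
  have p_neg: "fourier p k = 0" if "k < 0" for k
    unfolding p_eq[abs_def]
    by (rule fourier_mult_eq_0[where a = "- 1" and b = 1])
       (use w g g_neg that in \<open>auto simp: L2_cnj fourier_cnj L2_measurable ess_bounded_L2\<close>)
  have TJ: "(\<lambda>z. T z - JJ z) \<in> L2_plus" by (intro L2_plus_diff T JJ)
  \<comment> \<open>Having no negative frequencies, \<open>p\<close> is its own Szego projection,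
    which by the definition of \<open>p\<close> is \<open>T\<close> minus \<open>JJ\<close>.\<close>
  have "AE z in circle_measure. p z = T z - JJ z"
  proof (rule L2_plus_eqI)
    show "p \<in> L2_plus" using p p_neg by (simp add: L2_plus_def)
    fix k :: int assume "k \<ge> 0"
    then show "fourier p k = fourier (\<lambda>z. T z - JJ z) k"
      unfolding p_def T_def JJ_def
      by (simp add: fourier_diff L2_integrable L2_plusD(1)[OF J] L2_mult_cnj[OF w(1)] L2_mult_ess_bounded[OF w2]
          h toeplitz_L2_plus[OF w2 h] hankel_L2_plus[OF w(1)] L2_plusD(1) fourier_hankel[OF w(1)]
          fourier_toeplitz[OF w2])
  qed (rule TJ)
  then have eq: "AE z in circle_measure. abs_sq w z * w z * cnj (h z)
      = abs_sq w z * hankel w h z + (w z * cnj (T z) - w z * cnj (JJ z))"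
  proof eventually_elim
    case (elim z)
    have "abs_sq w z * w z * cnj (h z) = abs_sq w z * hankel w h z + abs_sq w z * g z"
      by (simp add: g_def algebra_simps)
    also have "abs_sq w z * g z = w z * cnj (p z)"
      by (simp add: p_eq abs_sq_eq_mult_cnj)
    finally show ?case using elim by (simp add: algebra_simps)
  qed
  note L2s = L2_mult_ess_bounded[OF w2 L2_plusD(1)[OF J]] L2_mult_cnj[OF w(1) L2_plusD(1)[OF T]]
    L2_mult_cnj[OF w(1) L2_plusD(1)[OF JJ]]
  have lhs: "(\<lambda>z. abs_sq w z * w z * cnj (h z)) \<in> L2"
    by (intro L2_mult_cnj[OF ess_bounded_mult[OF w2 w(1)]] h)
  have "fourier (\<lambda>z. abs_sq w z * w z * cnj (h z)) n
    = fourier (\<lambda>z. abs_sq w z * hankel w h z + (w z * cnj (T z) - w z * cnj (JJ z))) n"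
    by (rule fourier_cong_AE[OF eq]) (intro L2_measurable lhs L2_add L2_diff L2s)+
  also have "\<dots> = fourier (\<lambda>z. abs_sq w z * hankel w h z) n
    + fourier (\<lambda>z. w z * cnj (T z)) n - fourier (\<lambda>z. w z * cnj (JJ z)) n"
    by (simp add: fourier_add fourier_diff L2_integrable L2s L2_diff)
  finally show ?thesis by (simp add: T_def JJ_def)
qed

section \<open>The Lax identity\<close>

text \<open>Free of the projections in \<open>truncated_szego_field\<close>, so sup bounds on
  \<open>u\<close> and \<open>shift_adj u\<close> control it directly. It may fail to be analytic;
  Hankel operators on \<open>L2_plus\<close> see only its nonnegative frequencies.\<close>

definition lax_symbol :: "circle_fun \<Rightarrow> circle_fun" where
  "lax_symbol u z = abs_sq (\<lambda>z. u z / z) z * (u z / z) - abs_sq (shift_adj u) z * shift_adj u z"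

text \<open>Dividing by z lowers every frequency by 1, and projecting beforehand removes only
  frequencies that end up negative. Both sides synthesise the same coefficients, so they are equal
  outright.\<close>

lemma K_op_eq_hankel:
  assumes "ess_bounded B u" "h \<in> L2"
  shows "K_op u h = hankel (\<lambda>z. u z / z) h"
proof -
  have uh: "(\<lambda>z. u z * cnj (h z)) \<in> L2" by (rule L2_mult_cnj[OF assms])
  show ?thesis
    unfolding K_op_def hankel_def shift_adj_def szego_def[of "\<lambda>z. u z / z * _ z"]
    using fourier_divide[OF uh]
    by (intro arg_cong[where f = fourier_synth] ext) (auto simp: fourier_szego[OF uh])
qed

text \<open>Sobolev regularity enters the operator identities through these sup bounds. One
  \<open>B\<close> serves \<open>u\<close> and \<open>shift_adj u\<close>, as the Sobolev embedding
  controls both with the same constant.\<close>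

locale bounded_symbol =
  fixes u :: circle_fun and B :: real
  assumes u_bounded: "ess_bounded B u" and u_plus: "u \<in> L2_plus"
    and shift_adj_bounded: "ess_bounded B (shift_adj u)"
begin

abbreviation "v \<equiv> shift_adj u"
abbreviation "w \<equiv> \<lambda>z. u z / z"

lemma w_bounded: "ess_bounded B w"
  by (rule ess_bounded_divide[OF u_bounded])

lemma fourier_w: "fourier w n = fourier u (n + 1)"
  by (rule fourier_divide[OF ess_bounded_L2[OF u_bounded]])

lemma fourier_v: "fourier v n = (if n \<ge> 0 then fourier u (n + 1) else 0)"
  by (rule fourier_shift_adj[OF ess_bounded_L2[OF u_bounded]])

text \<open>\<open>w\<close> and \<open>v\<close> differ only in the frequency -1, and the conjugate
  of an analytic \<open>h\<close> cannot raise it. For such \<open>h\<close> either symbol may be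
  used.\<close>

lemma fourier_w_mult:
  assumes h: "h \<in> L2_plus" and n: "n \<ge> 0"
  shows "fourier (\<lambda>z. w z * cnj (h z)) n = fourier (\<lambda>z. v z * cnj (h z)) n"
proof -
  note h' = L2_plusD(1)[OF h]
  have "fourier (\<lambda>z. (w z - v z) * cnj (h z)) n = 0"
    by (rule fourier_mult_eq_0'[where a = "- 1" and b = 0])
       (use h h' n w_bounded shift_adj_bounded in \<open>auto simp: L2_cnj L2_diff ess_bounded_L2 fourier_cnj L2_measurable
          L2_plusD fourier_diff L2_integrable fourier_w fourier_v\<close>)
  then show ?thesis
    unfolding left_diff_distrib
    by (simp only: fourier_diff L2_integrable L2_mult_cnj[OF w_bounded h']
        L2_mult_cnj[OF shift_adj_bounded h'] right_minus_eq)
qed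

lemma hankel_w_eq_v: "h \<in> L2_plus \<Longrightarrow> hankel w h = hankel v h"
  unfolding hankel_def by (rule szego_cong) (rule fourier_w_mult)

lemma K_op_eq: "h \<in> L2_plus \<Longrightarrow> K_op u h = hankel v h"
  using K_op_eq_hankel[OF u_bounded] hankel_w_eq_v L2_plusD(1) by simp

lemma toeplitz_abs_sq_u: "h \<in> L2 \<Longrightarrow> toeplitz (abs_sq u) h = toeplitz (abs_sq w) h"
  unfolding toeplitz_def
proof (rule szego_cong, rule fourier_cong_AE)
  assume h: "h \<in> L2"
  show "AE z in circle_measure. abs_sq u z * h z = abs_sq w z * h z"
    by (rule AE_circleI) (simp add: abs_sq_def norm_divide)
qed (auto intro!: L2_measurable L2_mult_ess_bounded[OF ess_bounded_abs_sq[OF u_bounded]]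
    L2_mult_ess_bounded[OF ess_bounded_abs_sq[OF w_bounded]])

lemma D_op_eq:
  assumes h: "h \<in> L2_plus"
  shows "D_op u h = (\<lambda>z. - \<i> * (toeplitz (abs_sq w) h z - toeplitz (abs_sq v) h z))"
proof -
  have "K_op u (K_op u h) = hankel v (hankel v h)"
    using h by (simp add: K_op_eq hankel_L2_plus[OF shift_adj_bounded] L2_plusD(1))
  then show ?thesis
    unfolding D_op_def C_op_def B_op_def
    by (auto simp: toeplitz_abs_sq_u L2_plusD(1)[OF h] algebra_simps)
qed

lemma D_op_L2_plus: "h \<in> L2_plus \<Longrightarrow> D_op u h \<in> L2_plus"
  unfolding D_op_eq
  by (intro L2_plus_cmult L2_plus_diff toeplitz_L2_plus[OF ess_bounded_abs_sq]) 
     (auto intro: w_bounded shift_adj_bounded L2_plusD)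

lemma K_op_L2_plus: "h \<in> L2_plus \<Longrightarrow> K_op u h \<in> L2_plus"
  by (simp add: K_op_eq hankel_L2_plus[OF shift_adj_bounded] L2_plusD(1))

lemma lax_symbol_bounded: "ess_bounded (2 * B ^ 3) (lax_symbol u)"
  unfolding lax_symbol_def[abs_def]
  using ess_bounded_diff[OF ess_bounded_mult[OF ess_bounded_abs_sq[OF w_bounded] w_bounded]
      ess_bounded_mult[OF ess_bounded_abs_sq[OF shift_adj_bounded] shift_adj_bounded]]
  by (simp only: power3_eq_cube mult_2)

lemma commutator_L2_plus: "h \<in> L2_plus \<Longrightarrow> commutator (D_op u) (K_op u) h \<in> L2_plus"
  unfolding commutator_def by (intro L2_plus_diff D_op_L2_plus K_op_L2_plus)

theorem commutator_eq_hankel: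
  assumes h: "h \<in> L2_plus"
  shows "AE z in circle_measure.
    commutator (D_op u) (K_op u) h z = hankel (\<lambda>z. - \<i> * lax_symbol u z) h z"
proof (rule L2_plus_eqI)
  note h' = L2_plusD(1)[OF h]
  have sym: "ess_bounded (norm (- \<i>) * (2 * B ^ 3)) (\<lambda>z. - \<i> * lax_symbol u z)"
    by (rule ess_bounded_cmult[OF lax_symbol_bounded])
  show "hankel (\<lambda>z. - \<i> * lax_symbol u z) h \<in> L2_plus" by (rule hankel_L2_plus[OF sym h'])
  fix n :: int assume n: "n \<ge> 0"
  note ww = ess_bounded_abs_sq[OF w_bounded] and vv = ess_bounded_abs_sq[OF shift_adj_bounded]
  define T1 where "T1 = toeplitz (abs_sq w) h"
  define T2 where "T2 = toeplitz (abs_sq v) h"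
  define J where "J = hankel v h"
  have T1: "T1 \<in> L2_plus" and T2: "T2 \<in> L2_plus" and J: "J \<in> L2_plus"
    unfolding T1_def T2_def J_def
    by (intro toeplitz_L2_plus[OF ww] toeplitz_L2_plus[OF vv] hankel_L2_plus[OF shift_adj_bounded] h')+
  have J_w: "hankel w h = J" by (simp add: J_def hankel_w_eq_v h)
  have JJ: "hankel v J \<in> L2_plus" by (intro hankel_L2_plus[OF shift_adj_bounded] L2_plusD(1) J)
  have JJ_w: "hankel w J = hankel v J" by (rule hankel_w_eq_v[OF J])
  have DK: "fourier (D_op u J) n = - \<i> * (fourier (\<lambda>z. abs_sq w z * J z) n - fourier (\<lambda>z. abs_sq v z * J z) n)"
    unfolding D_op_eq[OF J]
    by (simp only: fourier_cmult fourier_diff L2_integrable L2_plusD(1)[OF toeplitz_L2_plus[OF ww]]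
       L2_plusD(1)[OF toeplitz_L2_plus[OF vv]] L2_plusD(1)[OF J] fourier_toeplitz[OF ww _ n] fourier_toeplitz[OF vv _ n])
  have "fourier (K_op u (D_op u h)) n = fourier (\<lambda>z. w z * cnj (D_op u h z)) n"
    by (simp add: K_op_eq_hankel[OF u_bounded] L2_plusD(1)[OF D_op_L2_plus[OF h]] fourier_hankel[OF w_bounded] n)
  \<comment> \<open>Antilinearity: -\<i> leaves the conjugation as \<i>, so that subtracting this
    term adds the second mixed product.\<close>
  also have "(\<lambda>z. w z * cnj (D_op u h z)) = (\<lambda>z. \<i> * (w z * cnj (T1 z) - w z * cnj (T2 z)))"
    by (auto simp: D_op_eq[OF h] T1_def T2_def algebra_simps)
  also have "fourier \<dots> n = \<i> * (fourier (\<lambda>z. w z * cnj (T1 z)) n - fourier (\<lambda>z. w z * cnj (T2 z)) n)"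
    by (simp only: fourier_cmult fourier_diff L2_integrable L2_mult_cnj[OF w_bounded] L2_plusD(1)[OF T1] L2_plusD(1)[OF T2])
  also have "fourier (\<lambda>z. w z * cnj (T2 z)) n = fourier (\<lambda>z. v z * cnj (T2 z)) n"
    by (rule fourier_w_mult[OF T2 n])
  finally have KD: "fourier (K_op u (D_op u h)) n
      = \<i> * (fourier (\<lambda>z. w z * cnj (T1 z)) n - fourier (\<lambda>z. v z * cnj (T2 z)) n)" .
  \<comment> \<open>As \<open>hankel v J\<close> lies in \<open>L2_plus\<close>, the last term may
    be written with \<open>v\<close> instead of \<open>w\<close>; it is then the same as in
    \<open>cub2\<close> and cancels.\<close>
  have cub1: "fourier (\<lambda>z. abs_sq w z * w z * cnj (h z)) n =
      fourier (\<lambda>z. abs_sq w z * J z) n + fourier (\<lambda>z. w z * cnj (T1 z)) n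
      - fourier (\<lambda>z. v z * cnj (hankel v J z)) n"
  proof -
    have "fourier w k = 0" if "k < - 1" for k using that by (simp add: fourier_w L2_plusD(2)[OF u_plus])
    from fourier_cubic_hankel[OF w_bounded this h', of n] show ?thesis
      by (simp only: J_w JJ_w fourier_w_mult[OF JJ n] T1_def)
  qed
  have cub2: "fourier (\<lambda>z. abs_sq v z * v z * cnj (h z)) n =
      fourier (\<lambda>z. abs_sq v z * J z) n + fourier (\<lambda>z. v z * cnj (T2 z)) n
      - fourier (\<lambda>z. v z * cnj (hankel v J z)) n"
    unfolding J_def T2_def
    by (rule fourier_cubic_hankel[OF shift_adj_bounded _ h']) (simp add: fourier_v)
  have "(\<lambda>z. - \<i> * lax_symbol u z * cnj (h z))
      = (\<lambda>z. - \<i> * (abs_sq w z * w z * cnj (h z) - abs_sq v z * v z * cnj (h z)))"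
    by (auto simp: lax_symbol_def algebra_simps)
  then have "fourier (hankel (\<lambda>z. - \<i> * lax_symbol u z) h) n
      = fourier (\<lambda>z. - \<i> * (abs_sq w z * w z * cnj (h z) - abs_sq v z * v z * cnj (h z))) n"
    by (simp only: fourier_hankel[OF sym h' n])
  also have "\<dots> = - \<i> * (fourier (\<lambda>z. abs_sq w z * w z * cnj (h z)) n - fourier (\<lambda>z. abs_sq v z * v z * cnj (h z)) n)"
    by (simp only: fourier_cmult fourier_diff L2_integrable L2_mult_cnj[OF ess_bounded_mult[OF ww w_bounded] h']
        L2_mult_cnj[OF ess_bounded_mult[OF vv shift_adj_bounded] h'])
  also have "\<dots> = fourier (D_op u J) n - fourier (K_op u (D_op u h)) n"
    unfolding DK KD cub1 cub2 by (simp add: algebra_simps)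
  also have "\<dots> = fourier (commutator (D_op u) (K_op u) h) n"
    unfolding commutator_def
    by (simp add: K_op_eq[OF h] J_def[symmetric] fourier_diff L2_integrable L2_plusD(1) D_op_L2_plus K_op_L2_plus h J)
  finally show "fourier (commutator (D_op u) (K_op u) h) n = fourier (hankel (\<lambda>z. - \<i> * lax_symbol u z) h) n" ..
qed (rule commutator_L2_plus[OF h])

lemma bounded_real_linear_K_op: "bounded_real_linear_op (K_op u)"
  by (rule bounded_real_linear_op_cong_AE[OF bounded_real_linear_hankel[OF shift_adj_bounded]])
     (simp_all add: K_op_L2_plus K_op_eq hankel_L2_plus[OF shift_adj_bounded] L2_plusD(1))

lemma bounded_real_linear_commutator: "bounded_real_linear_op (commutator (D_op u) (K_op u))"
  by (rule bounded_real_linear_op_cong_AE[OF bounded_real_linear_hankel[OF ess_bounded_cmult[OF lax_symbol_bounded]]])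
     (rule commutator_L2_plus commutator_eq_hankel; assumption)+

end

section \<open>Sobolev functions are bounded\<close>

text \<open>Pointwise convergence of the Fourier series is avoided: the trigonometric approximants
  are bounded by the sum and converge in \<open>L2\<close>, so the averages of \<open>f\<close> over
  all sets of positive measure lie in a closed disc, which forces its values there almost
  everywhere.\<close>

theorem ess_bounded_of_summable_fourier:
  assumes f: "f \<in> L2" and sum: "(\<lambda>n. norm (fourier f n)) summable_on UNIV"
  shows "ess_bounded (\<Sum>\<^sub>\<infinity>n. norm (fourier f n)) f"
proof -
  define A where "A = (\<Sum>\<^sub>\<infinity>n. norm (fourier f n))"
  have A: "A \<ge> 0" unfolding A_def by (rule infsum_nonneg) auto
  have avg: "norm (set_lebesgue_integral circle_measure E f) \<le> A * measure circle_measure E"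
    if E: "E \<in> sets borel" for E
  proof (rule field_le_epsilon)
    fix e :: real assume "e > 0"
    define ind where "ind = (\<lambda>z::complex. complex_of_real (indicator E z))"
    have ind: "ess_bounded 1 ind"
      using E by (auto simp: ess_bounded_def ind_def indicator_def)
    have ind_L2: "ind \<in> L2" by (rule ess_bounded_L2[OF ind])
    have ind_norm: "L2_norm ind \<le> 1"
    proof -
      have "L2_norm (\<lambda>z. ind z * 1) \<le> 1 * L2_norm (\<lambda>z. 1)"
        by (rule L2_norm_mult_ess_bounded[OF ind]) (simp add: L2_iff)
      then show ?thesis by (simp add: L2_norm_def)
    qed
    obtain F where F: "finite F" "L2_norm (\<lambda>z. f z - trig F (fourier f) z) \<le> e"
      using L2_trig_approximation[OF f \<open>e > 0\<close>] .
    define p where "p = trig F (fourier f)"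
    have p: "p \<in> L2" unfolding p_def by (rule L2_trig[OF F(1)])
    have fp: "(\<lambda>z. f z - p z) \<in> L2" by (rule L2_diff[OF f p])
    have p_le: "AE z in circle_measure. norm (p z) \<le> A"
      using trig_bounded[OF F(1), of "fourier f"]
    proof eventually_elim
      case (elim z)
      also have "(\<Sum>k\<in>F. norm (fourier f k)) \<le> A"
        unfolding A_def by (rule finite_sum_le_infsum[OF sum F(1)]) auto
      finally show ?case by (simp add: p_def)
    qed
    have "set_lebesgue_integral circle_measure E f
        = (\<integral>z. (f z - p z) * ind z + p z * ind z \<partial>circle_measure)"
      unfolding set_lebesgue_integral_def
      by (intro Bochner_Integration.integral_cong) (auto simp: ind_def scaleR_conv_of_real algebra_simps)
    also have "\<dots> = (\<integral>z. (f z - p z) * ind z \<partial>circle_measure) + (\<integral>z. p z * ind z \<partial>circle_measure)"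
      by (intro Bochner_Integration.integral_add L2_integrable_mult fp p ind_L2)
    also have "norm \<dots> \<le> A * measure circle_measure E + e"
    proof -
      have "norm (\<integral>z. (f z - p z) * ind z \<partial>circle_measure) \<le> L2_norm (\<lambda>z. f z - p z) * L2_norm ind"
        by (rule L2_norm_integral_mult[OF fp ind_L2])
      also have "\<dots> \<le> e * 1"
        using F(2) ind_norm \<open>e > 0\<close> by (intro mult_mono) (auto simp: p_def)
      finally have 1: "norm (\<integral>z. (f z - p z) * ind z \<partial>circle_measure) \<le> e" by simp
      have "norm (\<integral>z. p z * ind z \<partial>circle_measure) \<le> (\<integral>z. norm (p z * ind z) \<partial>circle_measure)"
        by (rule integral_norm_bound)
      also have "\<dots> \<le> (\<integral>z. A * indicator E z \<partial>circle_measure)"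
      proof (rule integral_mono_AE)
        show "AE z in circle_measure. norm (p z * ind z) \<le> A * indicator E z"
          using p_le by eventually_elim (auto simp: ind_def indicator_def norm_mult)
        show "integrable circle_measure (\<lambda>z. A * indicator E z)"
          using E by (intro integrable_mult_right integrable_real_indicator) (auto simp: circle.emeasure_finite less_top[symmetric])
      qed (intro integrable_norm L2_integrable_mult p ind_L2)
      also have "\<dots> = A * measure circle_measure E"
        using E by simp
      finally show ?thesis using 1 norm_triangle_ineq
        by (smt (verit, best))
    qed
    finally show "norm (set_lebesgue_integral circle_measure E f) \<le> A * measure circle_measure E + e" .
  qed
  have "AE z in circle_measure. f z \<in> cball 0 A"
  proof (rule circle.averaging_theorem[OF L2_integrable[OF f]])
    fix E assume E: "E \<in> sets circle_measure" "measure circle_measure E > 0"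
    then show "(1 / measure circle_measure E) *\<^sub>R set_lebesgue_integral circle_measure E f \<in> cball 0 A"
      using avg[of E] by (simp add: field_simps)
  qed auto
  then show ?thesis
    using A L2_measurable[OF f] by (auto simp: ess_bounded_def A_def)
qed

section \<open>Embedding of the Sobolev space into the Wiener algebra\<close>

lemma summable_sobolev_weights:
  assumes "s > 1 / 2"
  shows "(\<lambda>n::int. (1 + (real_of_int n)\<^sup>2) powr (- s)) summable_on UNIV"
proof -
  define g where "g = (\<lambda>n::int. (1 + (real_of_int n)\<^sup>2) powr (- s))"
  have "summable (\<lambda>n. g (int n))"
  proof (rule summable_comparison_test'[where N = 1])
    show "summable (\<lambda>n. real n powr (- 2 * s))"
      using assms by (simp add: summable_real_powr_iff)
    fix n :: nat assume n: "n \<ge> 1"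
    have "(1 + (real n)\<^sup>2) powr (- s) \<le> ((real n)\<^sup>2) powr (- s)"
      using n assms by (intro powr_mono2') auto
    also have "\<dots> = real n powr (- 2 * s)"
      using n by (simp add: powr_powr flip: powr_numeral)
    finally show "norm (g (int n)) \<le> real n powr (- 2 * s)" by (simp add: g_def)
  qed
  then have nat: "(\<lambda>n. g (int n)) summable_on UNIV"
    by (rule summable_nonneg_imp_summable_on) (simp add: g_def)
  have "g summable_on range int"
    using nat by (subst summable_on_reindex) (auto simp: o_def)
  moreover have "g summable_on range (\<lambda>n. - int n)"
    using nat by (subst summable_on_reindex) (auto simp: o_def g_def inj_on_def)
  ultimately have "g summable_on (range int \<union> range (\<lambda>n. - int n))"
    by (rule summable_on_union)
  also have "range int \<union> range (\<lambda>n. - int n) = UNIV"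
  proof -
    have "k \<in> range int \<union> range (\<lambda>n. - int n)" for k
      by (cases k rule: int_cases2) auto
    then show ?thesis by auto
  qed
  finally show ?thesis by (simp add: g_def)
qed

lemma Hs_L2: "f \<in> Hs s \<Longrightarrow> f \<in> L2"
  by (simp add: Hs_def)

lemma Hs_diff:
  assumes "f \<in> Hs s" "g \<in> Hs s"
  shows "(\<lambda>z. f z - g z) \<in> Hs s"
proof -
  let ?w = "\<lambda>n. (1 + (real_of_int n)\<^sup>2) powr s"
  note L2 = Hs_L2[OF assms(1)] Hs_L2[OF assms(2)]
  have "(\<lambda>n. norm (?w n * (norm (fourier (\<lambda>z. f z - g z) n))\<^sup>2)) summable_on UNIV"
  proof (rule Infinite_Sum.abs_summable_on_comparison_test')
    show "(\<lambda>n. 2 * (?w n * (norm (fourier f n))\<^sup>2) + 2 * (?w n * (norm (fourier g n))\<^sup>2)) summable_on UNIV"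
      using assms by (intro summable_on_add summable_on_cmult_right) (auto simp: Hs_def)
    fix n
    let ?a = "fourier f n" and ?b = "fourier g n"
    have "(norm (?a - ?b))\<^sup>2 \<le> (norm ?a + norm ?b)\<^sup>2"
      by (intro power_mono norm_triangle_ineq4) auto
    also have "\<dots> \<le> 2 * (norm ?a)\<^sup>2 + 2 * (norm ?b)\<^sup>2"
      using zero_le_power2[of "norm ?a - norm ?b"] by (simp add: power2_eq_square algebra_simps)
    finally have "?w n * (norm (?a - ?b))\<^sup>2 \<le> ?w n * (2 * (norm ?a)\<^sup>2 + 2 * (norm ?b)\<^sup>2)"
      by (rule mult_left_mono) simp
    then show "norm (?w n * (norm (fourier (\<lambda>z. f z - g z) n))\<^sup>2)
      \<le> 2 * (?w n * (norm ?a)\<^sup>2) + 2 * (?w n * (norm ?b)\<^sup>2)"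
      using L2 by (simp add: fourier_diff L2_integrable algebra_simps)
  qed
  then have "(\<lambda>n. ?w n * (norm (fourier (\<lambda>z. f z - g z) n))\<^sup>2) summable_on UNIV"
    by simp
  then show ?thesis using L2 by (simp add: Hs_def L2_diff)
qed

lemma Hs_norm_nonneg: "Hs_norm s f \<ge> 0"
  by (simp add: Hs_norm_def infsum_nonneg)

text \<open>Cauchy-Schwarz after splitting 1 into the weight 1 + n^2 to the powers -s/2 and s/2; the
  first factor is summable in square because s > 1/2. Finite sets are used since the uniform bound
  is what yields summability.\<close>

lemma Hs_sum_fourier_le:
  assumes s: "s > 1 / 2" and f: "f \<in> Hs s" and F: "finite F"
  shows "(\<Sum>n\<in>F. norm (fourier f n))
    \<le> sqrt (\<Sum>\<^sub>\<infinity>n::int. (1 + (real_of_int n)\<^sup>2) powr (- s)) * Hs_norm s f"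
proof -
  define a where "a = (\<lambda>n::int. (1 + (real_of_int n)\<^sup>2) powr (- s / 2))"
  define b where "b = (\<lambda>n::int. (1 + (real_of_int n)\<^sup>2) powr (s / 2) * norm (fourier f n))"
  have pos: "1 + (real_of_int n)\<^sup>2 > 0" for n
    by (simp add: add_pos_nonneg)
  have ab: "\<bar>a n\<bar> * \<bar>b n\<bar> = norm (fourier f n)" for n
    using pos[of n] by (simp add: a_def b_def abs_mult powr_minus flip: mult.assoc powr_add)
  have "(\<Sum>n\<in>F. norm (fourier f n)) \<le> L2_set a F * L2_set b F"
    using L2_set_mult_ineq[of a b F] by (simp only: ab)
  moreover have "L2_set a F \<le> sqrt (\<Sum>\<^sub>\<infinity>n::int. (1 + (real_of_int n)\<^sup>2) powr (- s))"
  proof -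
    have "(a n)\<^sup>2 = (1 + (real_of_int n)\<^sup>2) powr (- s)" for n
      by (simp add: a_def power2_eq_square flip: powr_add)
    then show ?thesis
      unfolding L2_set_def
      by (auto intro!: finite_sum_le_infsum F summable_sobolev_weights[OF s])
  qed
  moreover have "L2_set b F \<le> Hs_norm s f"
  proof -
    have "(b n)\<^sup>2 = (1 + (real_of_int n)\<^sup>2) powr s * (norm (fourier f n))\<^sup>2" for n
      by (simp add: b_def power2_eq_square mult_ac flip: powr_add)
    then show ?thesis
      unfolding L2_set_def Hs_norm_def using f
      by (auto intro!: finite_sum_le_infsum F simp: Hs_def)
  qed
  ultimately show ?thesis
    by (rule order_trans[OF _ mult_mono]) (simp_all add: infsum_nonneg L2_set_nonneg)
qed

text \<open>The constant comes from the weights alone. \<open>shift_adj\<close> only shifts and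
  discards coefficients, so the argument runs with an injection \<open>j\<close> of frequencies and
  gives it the same constant.\<close>

theorem sobolev_embedding:
  assumes s: "s > 1 / 2"
  obtains C where "C \<ge> 0" "\<And>f. f \<in> Hs s \<Longrightarrow> ess_bounded (C * Hs_norm s f) f"
    "\<And>f. f \<in> Hs s \<Longrightarrow> ess_bounded (C * Hs_norm s f) (shift_adj f)"
proof -
  define C where "C = sqrt (\<Sum>\<^sub>\<infinity>n::int. (1 + (real_of_int n)\<^sup>2) powr (- s))"
  have bdd: "ess_bounded (C * Hs_norm s f) g"
    if f: "f \<in> Hs s" and g: "g \<in> L2" and j: "inj j" "\<And>n. norm (fourier g n) \<le> norm (fourier f (j n))" for f g j
  proof -
    have le: "(\<Sum>n\<in>F. norm (fourier g n)) \<le> C * Hs_norm s f" if "finite F" for F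
    proof -
      have "(\<Sum>n\<in>F. norm (fourier g n)) \<le> (\<Sum>n\<in>F. norm (fourier f (j n)))"
        by (intro sum_mono j)
      also have "\<dots> = (\<Sum>n\<in>j ` F. norm (fourier f n))"
        using j(1) by (subst sum.reindex) (auto intro: inj_on_subset)
      also have "\<dots> \<le> C * Hs_norm s f"
        unfolding C_def using that by (intro Hs_sum_fourier_le[OF s f]) auto
      finally show ?thesis .
    qed
    then have "(\<lambda>n. norm (fourier g n)) summable_on UNIV"
      by (intro nonneg_bdd_above_summable_on bdd_aboveI[of _ "C * Hs_norm s f"]) auto
    then show ?thesis
      using ess_bounded_of_summable_fourier[OF g] infsum_le_finite_sums[OF _ le] ess_bounded_mono
      by blast
  qed
  show ?thesis
  proof (rule that)
    show "C \<ge> 0" unfolding C_def by (simp add: infsum_nonneg)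
    show "ess_bounded (C * Hs_norm s f) f" if "f \<in> Hs s" for f
      by (rule bdd[OF that Hs_L2[OF that], of "\<lambda>n. n"]) auto
    show "ess_bounded (C * Hs_norm s f) (shift_adj f)" if "f \<in> Hs s" for f
      by (rule bdd[OF that L2_shift_adj[OF Hs_L2[OF that]], of "\<lambda>n. n + 1"])
         (auto simp: fourier_shift_adj[OF Hs_L2[OF that]])
  qed
qed

section \<open>Differentiability of the Lax operator\<close>

text \<open>|a|^2 a is the product of a, a and its conjugate; exchanging the three factors for those
  of b one at a time costs M^2 \<delta> each.\<close>

lemma ess_bounded_cubic_diff:
  assumes a: "ess_bounded M a" and b: "ess_bounded M b" and d: "ess_bounded \<delta> (\<lambda>z. a z - b z)"
  shows "ess_bounded (3 * M\<^sup>2 * \<delta>) (\<lambda>z. abs_sq a z * a z - abs_sq b z * b z)"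
proof -
  note ac = ess_bounded_cnj[OF a] and dc = ess_bounded_cnj[OF d]
  have "ess_bounded (\<delta> * (M * M) + (M * (\<delta> * M) + (M * M) * \<delta>))
    (\<lambda>z. (a z - b z) * (a z * cnj (a z)) + (b z * ((a z - b z) * cnj (a z)) + (b z * b z) * cnj (a z - b z)))"
    by (intro ess_bounded_add ess_bounded_mult a b d ac dc)
  moreover have "(\<lambda>z. (a z - b z) * (a z * cnj (a z)) + (b z * ((a z - b z) * cnj (a z)) + (b z * b z) * cnj (a z - b z)))
    = (\<lambda>z. abs_sq a z * a z - abs_sq b z * b z)"
    by (auto simp: abs_sq_eq_mult_cnj algebra_simps)
  ultimately show ?thesis
    by (simp add: power2_eq_square algebra_simps)
qed

lemma ess_bounded_lax_symbol_diff:
  assumes u: "ess_bounded M u" "ess_bounded M (shift_adj u)"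
    and u': "ess_bounded M u'" "ess_bounded M (shift_adj u')"
    and d: "ess_bounded \<delta> (\<lambda>z. u z - u' z)" "ess_bounded \<delta> (shift_adj (\<lambda>z. u z - u' z))"
  shows "ess_bounded (6 * M\<^sup>2 * \<delta>) (\<lambda>z. lax_symbol u z - lax_symbol u' z)"
proof -
  note L2 = ess_bounded_L2[OF u(1)] ess_bounded_L2[OF u'(1)]
  \<comment> \<open>\<open>shift_adj\<close> is additive only up to null sets, because each
    coefficient sequence has its own chosen representative.\<close>
  have "AE z in circle_measure. shift_adj (\<lambda>z. u z - u' z) z = shift_adj u z - shift_adj u' z"
    by (rule fourier_eq_imp_AE_eq)
       (auto simp: L2 L2_shift_adj L2_diff fourier_shift_adj fourier_diff L2_integrable)
  then have d': "ess_bounded \<delta> (\<lambda>z. shift_adj u z - shift_adj u' z)"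
    by (rule ess_bounded_cong_AE[OF d(2), rotated])
       (intro L2_measurable L2_diff L2_shift_adj L2)
  have "ess_bounded \<delta> (\<lambda>z. u z / z - u' z / z)"
    using ess_bounded_divide[OF d(1)] by (simp add: diff_divide_distrib)
  from ess_bounded_diff[OF ess_bounded_cubic_diff[OF ess_bounded_divide[OF u(1)] ess_bounded_divide[OF u'(1)] this]
      ess_bounded_cubic_diff[OF u(2) u'(2) d']]
  have "ess_bounded (3 * M\<^sup>2 * \<delta> + 3 * M\<^sup>2 * \<delta>) (\<lambda>z.
      (abs_sq (\<lambda>z. u z / z) z * (u z / z) - abs_sq (\<lambda>z. u' z / z) z * (u' z / z))
      - (abs_sq (shift_adj u) z * shift_adj u z - abs_sq (shift_adj u') z * shift_adj u' z))" .
  then show ?thesis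
    unfolding lax_symbol_def by (simp add: algebra_simps)
qed

section \<open>The vector field compared with the Lax symbol\<close>

context bounded_symbol
begin

lemma u_cubic_bounded: "ess_bounded (B * B * B) (\<lambda>z. abs_sq u z * u z)"
  by (intro ess_bounded_mult ess_bounded_abs_sq u_bounded)

lemma v_cubic_bounded: "ess_bounded (B * B * B) (\<lambda>z. abs_sq v z * v z)"
  by (intro ess_bounded_mult ess_bounded_abs_sq shift_adj_bounded)

lemma szego_cubic_v_L2: "szego_cubic v \<in> L2"
  unfolding szego_cubic_def by (intro L2_szego ess_bounded_L2[OF v_cubic_bounded])

lemma szego_cubic_u_L2: "szego_cubic u \<in> L2"
  unfolding szego_cubic_def by (intro L2_szego ess_bounded_L2[OF u_cubic_bounded])

lemma shift_L2: "f \<in> L2 \<Longrightarrow> shift f \<in> L2"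
  unfolding shift_def
  by (rule L2_mult_bounded(1)[where B = 1]) (auto intro: AE_circleI)

lemma truncated_szego_field_L2: "truncated_szego_field u \<in> L2"
  unfolding truncated_szego_field_def
  by (intro L2_diff shift_L2 szego_cubic_v_L2 szego_cubic_u_L2)

text \<open>Coefficient n after division by z is coefficient n + 1 of the field, which the first
  projection keeps. The shift brings the second term back to n, where its projection changes nothing
  either.\<close>

lemma fourier_truncated_szego_field:
  assumes "n \<ge> 0"
  shows "fourier (\<lambda>z. truncated_szego_field u z / z) n = fourier (lax_symbol u) n"
proof -
  have sh: "fourier (shift f) k = fourier f (k - 1)" if "f \<in> L2" for f k
    using fourier_mult_powi[OF L2_integrable[OF that], of 1 k] by (simp add: shift_def)
  have u3: "(\<lambda>z. abs_sq u z * u z) \<in> L2" by (rule ess_bounded_L2[OF u_cubic_bounded])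
  have v3: "(\<lambda>z. abs_sq v z * v z) \<in> L2" by (rule ess_bounded_L2[OF v_cubic_bounded])
  have w3: "(\<lambda>z. abs_sq w z * w z) \<in> L2"
    by (rule ess_bounded_L2[OF ess_bounded_mult[OF ess_bounded_abs_sq[OF w_bounded] w_bounded]])
  have "fourier (\<lambda>z. truncated_szego_field u z / z) n = fourier (truncated_szego_field u) (n + 1)"
    by (rule fourier_divide[OF truncated_szego_field_L2])
  also have "\<dots> = fourier (szego_cubic u) (n + 1) - fourier (shift (szego_cubic v)) (n + 1)"
    unfolding truncated_szego_field_def
    by (intro fourier_diff L2_integrable shift_L2 szego_cubic_v_L2 szego_cubic_u_L2)
  also have "\<dots> = fourier (\<lambda>z. abs_sq u z * u z) (n + 1) - fourier (\<lambda>z. abs_sq v z * v z) n"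
    using assms by (simp add: sh szego_cubic_v_L2)
      (simp add: szego_cubic_def fourier_szego u3 v3)
  also have "fourier (\<lambda>z. abs_sq u z * u z) (n + 1) = fourier (\<lambda>z. abs_sq u z * u z / z) n"
    by (rule fourier_divide[OF u3, symmetric])
  also have "\<dots> = fourier (\<lambda>z. abs_sq w z * w z) n"
  proof (rule fourier_cong_AE)
    show "AE z in circle_measure. abs_sq u z * u z / z = abs_sq w z * w z"
      by (rule AE_circleI) (simp add: abs_sq_def norm_divide)
    show "(\<lambda>z. abs_sq u z * u z / z) \<in> borel_measurable borel"
      by (rule ess_bounded_measurable[OF ess_bounded_divide[OF u_cubic_bounded]])
  qed (rule L2_measurable[OF w3])
  also have "\<dots> - fourier (\<lambda>z. abs_sq v z * v z) n = fourier (lax_symbol u) n"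
    unfolding lax_symbol_def[abs_def] by (intro fourier_diff[symmetric] L2_integrable w3 v3)
  finally show ?thesis .
qed

text \<open>The field divided by z and the symbol differ only in negative frequencies, while
  \<open>q\<close> has none above 0, so the difference times \<open>q\<close> has mean zero. The
  pairing thus passes to a bounded symbol.\<close>

lemma integral_truncated_szego_field:
  assumes q: "q \<in> L2" "\<And>n. n > 0 \<Longrightarrow> fourier q n = 0"
  shows "(\<integral>z. truncated_szego_field u z * (q z / z) \<partial>circle_measure)
    = (\<integral>z. lax_symbol u z * q z \<partial>circle_measure)"
proof -
  have F: "(\<lambda>z. truncated_szego_field u z / z) \<in> L2"
    unfolding divide_eq_powi
    by (rule L2_mult_bounded(1)[where B = 1]) (auto intro!: AE_circleI truncated_szego_field_L2 simp: norm_inverse power_int_minus)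
  have G: "lax_symbol u \<in> L2" by (rule ess_bounded_L2[OF lax_symbol_bounded])
  have "fourier (\<lambda>z. (truncated_szego_field u z / z - lax_symbol u z) * q z) 0 = 0"
    by (rule fourier_mult_eq_0'[where a = "- 1" and b = 0])
       (use F G q in \<open>auto simp: L2_diff fourier_diff L2_integrable fourier_truncated_szego_field\<close>)
  then have "(\<integral>z. (truncated_szego_field u z / z) * q z - lax_symbol u z * q z \<partial>circle_measure) = 0"
    by (simp add: fourier_def left_diff_distrib)
  then show ?thesis
    using Bochner_Integration.integral_diff[OF L2_integrable_mult[OF F q(1)] L2_integrable_mult[OF G q(1)]]
    by simp
qed

end

section \<open>Differentiation along a solution\<close>

locale truncated_szego_solution =
  fixes s :: real and u :: "real \<Rightarrow> circle_fun"
  assumes s: "s > 1 / 2" and continuous: "continuous_Hs_plus s u" and solves: "solves_truncated_szego u"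
begin

lemma u_Hs: "u t \<in> Hs s" and u_L2_plus: "u t \<in> L2_plus"
  using continuous by (auto simp: continuous_Hs_plus_def Hs_plus_def)

lemma u_L2: "u t \<in> L2"
  by (rule L2_plusD(1)[OF u_L2_plus])

lemma bounded_symbol_u: "\<exists>B. bounded_symbol (u t) B"
proof -
  obtain C where "\<And>f. f \<in> Hs s \<Longrightarrow> ess_bounded (C * Hs_norm s f) f"
    "\<And>f. f \<in> Hs s \<Longrightarrow> ess_bounded (C * Hs_norm s f) (shift_adj f)"
    using sobolev_embedding[OF s] by metis
  then have "bounded_symbol (u t) (C * Hs_norm s (u t))"
    by unfold_locales (auto intro: u_Hs u_L2_plus)
  then show ?thesis ..
qed

lemma u_ess_bounded: "\<exists>B. ess_bounded B (u t)"
  using bounded_symbol_u[of t] by (auto dest: bounded_symbol.u_bounded)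

lemma lax_symbol_ess_bounded: "\<exists>B. ess_bounded B (lax_symbol (u t))"
  using bounded_symbol_u[of t] by (auto dest: bounded_symbol.lax_symbol_bounded)

lemma lax_symbol_L2: "lax_symbol (u t) \<in> L2"
  using lax_symbol_ess_bounded ess_bounded_L2 by blast

lemma lax_symbol_continuous:
  assumes "\<epsilon> > 0"
  obtains \<delta> where "\<delta> > 0"
    "\<And>r. \<bar>r - t\<bar> < \<delta> \<Longrightarrow> ess_bounded \<epsilon> (\<lambda>z. lax_symbol (u r) z - lax_symbol (u t) z)"
proof -
  obtain C where C: "C \<ge> 0" "\<And>f. f \<in> Hs s \<Longrightarrow> ess_bounded (C * Hs_norm s f) f"
    "\<And>f. f \<in> Hs s \<Longrightarrow> ess_bounded (C * Hs_norm s f) (shift_adj f)"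
    using sobolev_embedding[OF s] by metis
  \<comment> \<open>The extra 1 makes room for \<open>u r\<close>: since \<eta> will be at most 1,
    the same \<open>M\<close> bounds it too.\<close>
  define M where "M = C * Hs_norm s (u t) + 1"
  have M: "M \<ge> 1" using C(1) Hs_norm_nonneg[of s "u t"] by (simp add: M_def)
  \<comment> \<open>6 M^2 is the local Lipschitz constant from
    \<open>ess_bounded_lax_symbol_diff\<close>.\<close>
  define \<eta> where "\<eta> = min 1 (\<epsilon> / (6 * M\<^sup>2))"
  have \<eta>: "\<eta> > 0" "\<eta> \<le> 1" "6 * M\<^sup>2 * \<eta> \<le> \<epsilon>"
  proof -
    have "M\<^sup>2 > 0" using M by simp
    then show "\<eta> > 0" "\<eta> \<le> 1" using assms by (auto simp: \<eta>_def)
    have "6 * M\<^sup>2 * \<eta> \<le> 6 * M\<^sup>2 * (\<epsilon> / (6 * M\<^sup>2))"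
      by (intro mult_left_mono) (auto simp: \<eta>_def)
    then show "6 * M\<^sup>2 * \<eta> \<le> \<epsilon>" using \<open>M\<^sup>2 > 0\<close> by simp
  qed
  have "((\<lambda>r. C * Hs_norm s (\<lambda>z. u r z - u t z)) \<longlongrightarrow> C * 0) (at t)"
    using continuous by (intro tendsto_mult tendsto_const) (auto simp: continuous_Hs_plus_def)
  then have "\<forall>\<^sub>F r in at t. C * Hs_norm s (\<lambda>z. u r z - u t z) < \<eta>"
    using \<eta>(1) by (auto intro: order_tendstoD)
  then obtain \<delta> where \<delta>: "\<delta> > 0"
    "\<And>r. r \<noteq> t \<Longrightarrow> dist r t < \<delta> \<Longrightarrow> C * Hs_norm s (\<lambda>z. u r z - u t z) < \<eta>"
    unfolding eventually_at by auto
  have "ess_bounded \<epsilon> (\<lambda>z. lax_symbol (u r) z - lax_symbol (u t) z)" if r: "\<bar>r - t\<bar> < \<delta>" for r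
  proof (cases "r = t")
    case True
    then show ?thesis using assms by (simp add: ess_bounded_def)
  next
    case False
    have diff: "(\<lambda>z. u r z - u t z) \<in> Hs s" by (intro Hs_diff u_Hs)
    have le: "C * Hs_norm s (\<lambda>z. u r z - u t z) \<le> \<eta>"
      using \<delta>(2)[of r] False r by (simp add: dist_real_def)
    have d: "ess_bounded \<eta> (\<lambda>z. u r z - u t z)" "ess_bounded \<eta> (shift_adj (\<lambda>z. u r z - u t z))"
      using ess_bounded_mono[OF C(2)[OF diff] le] ess_bounded_mono[OF C(3)[OF diff] le] by auto
    have t: "ess_bounded (C * Hs_norm s (u t)) (u t)" "ess_bounded (C * Hs_norm s (u t)) (shift_adj (u t))"
      using C u_Hs by auto
    have tM: "ess_bounded M (u t)" "ess_bounded M (shift_adj (u t))"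
      using t by (auto intro: ess_bounded_mono simp: M_def)
    have le_M: "\<eta> + C * Hs_norm s (u t) \<le> M" using \<eta>(2) by (simp add: M_def)
    have rM: "ess_bounded M (u r)"
      using ess_bounded_mono[OF ess_bounded_add[OF d(1) t(1)] le_M] by simp
    have "AE z in circle_measure. shift_adj (\<lambda>z. u r z - u t z) z + shift_adj (u t) z = shift_adj (u r) z"
      by (rule fourier_eq_imp_AE_eq)
         (auto simp: u_L2 L2_shift_adj L2_add L2_diff fourier_shift_adj fourier_diff fourier_add L2_integrable)
    then have rM': "ess_bounded M (shift_adj (u r))"
      by (rule ess_bounded_cong_AE[OF ess_bounded_mono[OF ess_bounded_add[OF d(2) t(2)] le_M], rotated])
         (intro L2_measurable L2_shift_adj u_L2)
    show ?thesis
      using ess_bounded_mono[OF ess_bounded_lax_symbol_diff[OF rM rM' tM d] \<eta>(3)] .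
  qed
  with \<delta>(1) show ?thesis by (rule that)
qed

text \<open>Pairing with a fixed \<open>L2\<close> function turns the \<open>L2\<close> derivative
  into a scalar one by Cauchy-Schwarz. The condition on the spectrum of \<open>q\<close> replaces
  the field by \<open>lax_symbol\<close>, whose continuity in time is known.\<close>

lemma has_vector_derivative_pairing:
  assumes q: "q \<in> L2" "\<And>n. n > 0 \<Longrightarrow> fourier q n = 0"
  shows "((\<lambda>r. \<integral>z. u r z / z * q z \<partial>circle_measure) has_vector_derivative
    - \<i> * (\<integral>z. lax_symbol (u t) z * q z \<partial>circle_measure)) (at t)"
proof -
  obtain B where "bounded_symbol (u t) B" using bounded_symbol_u by blast
  then interpret bounded_symbol "u t" B .
  define p where "p = (\<lambda>z. q z / z)"
  have p: "p \<in> L2"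
    unfolding p_def divide_eq_powi
    by (rule L2_mult_bounded(1)[where B = 1]) (auto intro!: AE_circleI q simp: norm_inverse power_int_minus)
  \<comment> \<open>The residual of the equation: up to the factor \<i>, its pairing with
    \<open>p\<close> is the error of the scalar difference quotient.\<close>
  define R where "R = (\<lambda>r z. \<i> * ((u r z - u t z) / complex_of_real (r - t)) - truncated_szego_field (u t) z)"
  define \<phi> where "\<phi> = (\<lambda>r. \<integral>z. u r z * p z \<partial>circle_measure)"
  define D where "D = - \<i> * (\<integral>z. lax_symbol (u t) z * q z \<partial>circle_measure)"
  have D: "D = - \<i> * (\<integral>z. truncated_szego_field (u t) z * p z \<partial>circle_measure)"
    using integral_truncated_szego_field[OF q] by (simp add: D_def p_def)
  have R_L2: "R r \<in> L2" for r
  proof -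
    have "R r = (\<lambda>z. (\<i> / complex_of_real (r - t)) * (u r z - u t z) - truncated_szego_field (u t) z)"
      by (auto simp: R_def)
    then show ?thesis by (simp only: L2_diff L2_cmult u_L2 truncated_szego_field_L2)
  qed
  have R_int: "(\<integral>z. R r z * p z \<partial>circle_measure) = \<i> * ((\<phi> r - \<phi> t) / complex_of_real (r - t) - D)" for r
  proof -
    define c where "c = \<i> / complex_of_real (r - t)"
    have "(\<integral>z. R r z * p z \<partial>circle_measure)
      = (\<integral>z. c * (u r z * p z - u t z * p z) - truncated_szego_field (u t) z * p z \<partial>circle_measure)"
      by (simp add: R_def c_def algebra_simps diff_divide_distrib)
    also have "\<dots> = c * (\<phi> r - \<phi> t) - (\<integral>z. truncated_szego_field (u t) z * p z \<partial>circle_measure)"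
      unfolding \<phi>_def
      by (simp only: Bochner_Integration.integral_diff integrable_mult_right integral_mult_right_zero
          Bochner_Integration.integrable_diff L2_integrable_mult p u_L2 truncated_szego_field_L2)
    also have "\<dots> = \<i> * ((\<phi> r - \<phi> t) / complex_of_real (r - t) - D)"
      by (simp add: c_def D algebra_simps)
    finally show ?thesis .
  qed
  have "((\<lambda>r. L2_norm (R r)) \<longlongrightarrow> 0) (at t)"
    using solves unfolding solves_truncated_szego_def R_def by blast
  then have lim: "((\<lambda>r. L2_norm (R r) * L2_norm p) \<longlongrightarrow> 0) (at t)"
    by (rule tendsto_mult_left_zero)
  have "((\<lambda>r. norm ((\<phi> r - \<phi> t) - (r - t) *\<^sub>R D) / norm (r - t)) \<longlongrightarrow> 0) (at t)"
  proof (rule tendsto_sandwich[OF _ _ tendsto_const lim])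
    show "\<forall>\<^sub>F r in at t. 0 \<le> norm ((\<phi> r - \<phi> t) - (r - t) *\<^sub>R D) / norm (r - t)"
      by simp
    have "norm ((\<phi> r - \<phi> t) - (r - t) *\<^sub>R D) / norm (r - t) \<le> L2_norm (R r) * L2_norm p" if "r \<noteq> t" for r
    proof -
      have "norm ((\<phi> r - \<phi> t) - (r - t) *\<^sub>R D) / norm (r - t)
        = norm (((\<phi> r - \<phi> t) - (r - t) *\<^sub>R D) / complex_of_real (r - t))"
        by (simp only: norm_divide norm_of_real real_norm_def)
      also have "((\<phi> r - \<phi> t) - (r - t) *\<^sub>R D) / complex_of_real (r - t) = (\<phi> r - \<phi> t) / complex_of_real (r - t) - D"
        using that by (simp add: diff_divide_distrib scaleR_conv_of_real flip: of_real_diff)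
      also have "norm \<dots> = norm (\<integral>z. R r z * p z \<partial>circle_measure)"
        by (simp add: R_int norm_mult)
      also have "\<dots> \<le> L2_norm (R r) * L2_norm p"
        by (rule L2_norm_integral_mult[OF R_L2 p])
      finally show ?thesis .
    qed
    then show "\<forall>\<^sub>F r in at t. norm ((\<phi> r - \<phi> t) - (r - t) *\<^sub>R D) / norm (r - t) \<le> L2_norm (R r) * L2_norm p"
      by (auto simp: eventually_at_filter)
  qed
  then have "(\<phi> has_vector_derivative D) (at t)"
    unfolding has_vector_derivative_def has_derivative_iff_norm
    by (auto intro: bounded_linear_scaleR_left)
  then show ?thesis by (simp add: \<phi>_def D_def p_def)
qed

text \<open>On \<open>L2_plus\<close> this is a symbol for the difference quotient of
  \<open>K_op\<close> minus the commutator. The plus sign arises because the commutator has the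
  symbol -\<i> times \<open>lax_symbol\<close>.\<close>

definition quotient_defect :: "real \<Rightarrow> real \<Rightarrow> circle_fun" where
  "quotient_defect t r z = (u r z / z - u t z / z) / complex_of_real (r - t) + \<i> * lax_symbol (u t) z"

text \<open>The bound obtained may blow up as r tends to t. It makes the Hankel operator available
  and supports the density argument, but does not enter the final estimate.\<close>

lemma quotient_defect_bounded: "\<exists>B. ess_bounded B (quotient_defect t r)"
proof -
  obtain B1 B2 B3 where B: "ess_bounded B1 (u r)" "ess_bounded B2 (u t)" "ess_bounded B3 (lax_symbol (u t))"
    using u_ess_bounded lax_symbol_ess_bounded by metis
  have "quotient_defect t r
    = (\<lambda>z. (1 / complex_of_real (r - t)) * (u r z / z - u t z / z) + \<i> * lax_symbol (u t) z)"
    by (auto simp: quotient_defect_def)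
  moreover have "ess_bounded (norm (1 / complex_of_real (r - t)) * (B1 + B2) + norm \<i> * B3)
    (\<lambda>z. (1 / complex_of_real (r - t)) * (u r z / z - u t z / z) + \<i> * lax_symbol (u t) z)"
    by (intro ess_bounded_add ess_bounded_cmult ess_bounded_diff ess_bounded_divide B)
  ultimately show ?thesis by auto
qed

text \<open>The mean value inequality for the scalar pairing, whose derivative varies near t by at
  most \<epsilon> times the norms of \<open>h\<close> and \<open>g\<close>. Boundedness of
  \<open>h\<close> puts the product of the conjugates into \<open>L2\<close>; its bound
  \<open>C\<close> is absent from the estimate, which permits the passage to general
  \<open>h\<close>.\<close>

lemma quotient_defect_pairing_bounded:
  assumes \<delta>: "\<And>\<tau>. \<bar>\<tau> - t\<bar> < \<delta> \<Longrightarrow> ess_bounded \<epsilon> (\<lambda>z. lax_symbol (u \<tau>) z - lax_symbol (u t) z)"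
    and r: "\<bar>r - t\<bar> < \<delta>" "r \<noteq> t"
    and h: "h \<in> L2_plus" "ess_bounded C h" and g: "g \<in> L2_plus"
  shows "norm (\<integral>z. quotient_defect t r z * (cnj (h z) * cnj (g z)) \<partial>circle_measure)
    \<le> \<epsilon> * (L2_norm h * L2_norm g)"
proof -
  define q where "q = (\<lambda>z. cnj (h z) * cnj (g z))"
  have hc: "(\<lambda>z. cnj (h z)) \<in> L2" and gc: "(\<lambda>z. cnj (g z)) \<in> L2"
    using h(1) g by (auto intro: L2_cnj L2_plusD)
  have q: "q \<in> L2"
    unfolding q_def by (rule L2_mult_ess_bounded[OF ess_bounded_cnj[OF h(2)] gc])
  have q_plus: "fourier q n = 0" if "n > 0" for n
    unfolding q_def
    by (rule fourier_mult_eq_0'[where a = 0 and b = 0])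
       (use that h g hc gc in \<open>auto simp: fourier_cnj L2_measurable L2_plusD\<close>)
  define \<phi> where "\<phi> = (\<lambda>r. \<integral>z. u r z / z * q z \<partial>circle_measure)"
  define \<psi> where "\<psi> = (\<lambda>r. \<integral>z. lax_symbol (u r) z * q z \<partial>circle_measure)"
  have \<psi>_le: "norm (\<psi> \<tau> - \<psi> t) \<le> \<epsilon> * (L2_norm h * L2_norm g)" if "\<bar>\<tau> - t\<bar> < \<delta>" for \<tau>
  proof -
    let ?d = "\<lambda>z. lax_symbol (u \<tau>) z - lax_symbol (u t) z"
    have "\<psi> \<tau> - \<psi> t = (\<integral>z. lax_symbol (u \<tau>) z * q z - lax_symbol (u t) z * q z \<partial>circle_measure)"
      unfolding \<psi>_def
      by (intro Bochner_Integration.integral_diff[symmetric] L2_integrable_mult lax_symbol_L2 q)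
    \<comment> \<open>The symbol difference is grouped with \<open>h\<close>; an estimate by the
      norm of \<open>q\<close> would bring in \<open>C\<close>.\<close>
    also have "\<dots> = (\<integral>z. (?d z * cnj (h z)) * cnj (g z) \<partial>circle_measure)"
      by (simp add: q_def algebra_simps)
    also have "norm \<dots> \<le> L2_norm (\<lambda>z. ?d z * cnj (h z)) * L2_norm (\<lambda>z. cnj (g z))"
      by (rule L2_norm_integral_mult[OF L2_mult_ess_bounded[OF \<delta>[OF that] hc] gc])
    also have "\<dots> \<le> (\<epsilon> * L2_norm (\<lambda>z. cnj (h z))) * L2_norm (\<lambda>z. cnj (g z))"
      by (intro mult_right_mono L2_norm_mult_ess_bounded[OF \<delta>[OF that] hc]) simp
    finally show ?thesis by (simp add: mult.assoc)
  qed
  have "norm (\<phi> r - \<phi> t - (r - t) *\<^sub>R (- \<i> * \<psi> t)) \<le> norm (r - t) * (\<epsilon> * (L2_norm h * L2_norm g))"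
  proof (rule vector_differentiable_bound_linearization[where S = "ball t \<delta>" and f' = "\<lambda>\<tau>. - \<i> * \<psi> \<tau>"])
    fix \<tau> assume \<tau>: "\<tau> \<in> ball t \<delta>"
    show "(\<phi> has_vector_derivative - \<i> * \<psi> \<tau>) (at \<tau> within ball t \<delta>)"
      unfolding \<phi>_def \<psi>_def
      by (rule has_vector_derivative_at_within[OF has_vector_derivative_pairing[OF q q_plus]])
    have "norm (- \<i> * \<psi> \<tau> - - \<i> * \<psi> t) = norm (\<psi> \<tau> - \<psi> t)"
      by (simp add: norm_mult flip: right_diff_distrib) (simp add: norm_minus_commute)
    then show "norm (- \<i> * \<psi> \<tau> - - \<i> * \<psi> t) \<le> \<epsilon> * (L2_norm h * L2_norm g)"
      using \<psi>_le[of \<tau>] \<tau> by (simp add: dist_real_def abs_minus_commute)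
  next
    show "closed_segment t r \<subseteq> ball t \<delta>"
      using r by (intro closed_segment_subset convex_ball) (auto simp: dist_real_def abs_minus_commute)
    show "t \<in> ball t \<delta>" using r by simp
  qed
  moreover have "(\<integral>z. quotient_defect t r z * q z \<partial>circle_measure)
    = (\<phi> r - \<phi> t - (r - t) *\<^sub>R (- \<i> * \<psi> t)) / complex_of_real (r - t)"
  proof -
    define c where "c = 1 / complex_of_real (r - t)"
    have w: "(\<lambda>z. u r z / z) \<in> L2" for r
      using u_ess_bounded[of r] by (auto intro: ess_bounded_L2 ess_bounded_divide)
    have "(\<integral>z. quotient_defect t r z * q z \<partial>circle_measure)
      = (\<integral>z. c * (u r z / z * q z - u t z / z * q z) + \<i> * (lax_symbol (u t) z * q z) \<partial>circle_measure)"
      by (simp add: quotient_defect_def c_def algebra_simps diff_divide_distrib)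
    also have "\<dots> = c * (\<phi> r - \<phi> t) + \<i> * \<psi> t"
      unfolding \<phi>_def \<psi>_def
      by (simp only: Bochner_Integration.integral_diff Bochner_Integration.integral_add integrable_mult_right
          integral_mult_right_zero Bochner_Integration.integrable_diff L2_integrable_mult w q lax_symbol_L2)
    also have "\<dots> = (\<phi> r - \<phi> t - (r - t) *\<^sub>R (- \<i> * \<psi> t)) / complex_of_real (r - t)"
      using r(2) by (simp add: c_def scaleR_conv_of_real field_simps flip: of_real_diff)
    finally show ?thesis .
  qed
  moreover have "norm (complex_of_real (r - t)) = norm (r - t)" by (simp only: norm_of_real real_norm_def)
  ultimately show ?thesis
    using r(2) by (simp add: norm_divide q_def pos_divide_le_eq mult.commute flip: of_real_diff)
qed

text \<open>Partial Fourier sums of \<open>h\<close> are bounded, analytic and of norm at most that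
  of \<open>h\<close>. The error is measured with the sup bound of the defect at fixed r, and the
  accuracy \<open>d\<close> is chosen to absorb it.\<close>

lemma quotient_defect_pairing:
  assumes \<delta>: "\<And>\<tau>. \<bar>\<tau> - t\<bar> < \<delta> \<Longrightarrow> ess_bounded \<epsilon> (\<lambda>z. lax_symbol (u \<tau>) z - lax_symbol (u t) z)"
    and r: "\<bar>r - t\<bar> < \<delta>" "r \<noteq> t"
    and h: "h \<in> L2_plus" and g: "g \<in> L2_plus"
  shows "norm (\<integral>z. quotient_defect t r z * (cnj (h z) * cnj (g z)) \<partial>circle_measure)
    \<le> \<epsilon> * (L2_norm h * L2_norm g)"
proof (rule field_le_epsilon)
  fix e :: real assume "e > 0"
  note h' = L2_plusD(1)[OF h] and g' = L2_plusD(1)[OF g]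
  obtain B where B: "ess_bounded B (quotient_defect t r)" using quotient_defect_bounded by blast
  have \<epsilon>: "\<epsilon> \<ge> 0" using ess_bounded_nonneg[OF \<delta>[of t]] r by simp
  have B0: "B \<ge> 0" by (rule ess_bounded_nonneg[OF B])
  define d where "d = e / (B * L2_norm g + 1)"
  have "B * L2_norm g \<ge> 0" using B0 by simp
  then have d: "d > 0" "B * d * L2_norm g \<le> e"
    using \<open>e > 0\<close> by (auto simp: d_def field_simps)
  obtain F where F: "finite F" "L2_norm (\<lambda>z. h z - trig F (fourier h) z) \<le> d"
    using L2_trig_approximation[OF h' d(1)] .
  define p where "p = trig F (fourier h)"
  have p: "p \<in> L2_plus"
    using L2_trig[OF F(1)] L2_plusD(2)[OF h] by (auto simp: p_def L2_plus_def fourier_trig F(1))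
  have p_bounded: "ess_bounded (\<Sum>k\<in>F. norm (fourier h k)) p"
    using trig_bounded[OF F(1)] by (auto simp: ess_bounded_def p_def sum_nonneg)
  have p_norm: "L2_norm p \<le> L2_norm h"
    using bessel[OF F(1) h'] by (intro power2_le_imp_le[OF _ L2_norm_nonneg]) (simp add: p_def L2_norm_trig F(1))
  note p' = L2_plusD(1)[OF p]
  have hp: "(\<lambda>z. h z - p z) \<in> L2" by (rule L2_diff[OF h' p'])
  note L = L2_mult_cnj[OF B hp] L2_mult_cnj[OF B p']
  have "(\<integral>z. quotient_defect t r z * (cnj (h z) * cnj (g z)) \<partial>circle_measure)
    = (\<integral>z. (quotient_defect t r z * cnj (h z - p z)) * cnj (g z)
          + (quotient_defect t r z * cnj (p z)) * cnj (g z) \<partial>circle_measure)"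
    by (simp add: algebra_simps)
  also have "\<dots> = (\<integral>z. (quotient_defect t r z * cnj (h z - p z)) * cnj (g z) \<partial>circle_measure)
      + (\<integral>z. (quotient_defect t r z * cnj (p z)) * cnj (g z) \<partial>circle_measure)"
    by (intro Bochner_Integration.integral_add L2_integrable_mult L L2_cnj g')
  also have "norm \<dots> \<le> e + \<epsilon> * (L2_norm h * L2_norm g)"
  proof (rule norm_triangle_mono)
    have "norm (\<integral>z. (quotient_defect t r z * cnj (h z - p z)) * cnj (g z) \<partial>circle_measure)
      \<le> L2_norm (\<lambda>z. quotient_defect t r z * cnj (h z - p z)) * L2_norm (\<lambda>z. cnj (g z))"
      by (intro L2_norm_integral_mult L L2_cnj g')
    also have "\<dots> \<le> (B * L2_norm (\<lambda>z. cnj (h z - p z))) * L2_norm g"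
      unfolding L2_norm_cnj[of g]
      by (intro mult_right_mono L2_norm_mult_ess_bounded[OF B L2_cnj[OF hp]]) simp
    also have "\<dots> \<le> (B * d) * L2_norm g"
      unfolding L2_norm_cnj using F(2) B0 by (intro mult_right_mono mult_left_mono) (auto simp: p_def)
    also have "\<dots> \<le> e" by (rule d(2))
    finally show "norm (\<integral>z. (quotient_defect t r z * cnj (h z - p z)) * cnj (g z) \<partial>circle_measure) \<le> e" .
    have "norm (\<integral>z. quotient_defect t r z * (cnj (p z) * cnj (g z)) \<partial>circle_measure)
        \<le> \<epsilon> * (L2_norm p * L2_norm g)"
      by (rule quotient_defect_pairing_bounded[OF \<delta> r p p_bounded g])
    also have "\<dots> \<le> \<epsilon> * (L2_norm h * L2_norm g)"
      by (intro mult_left_mono mult_right_mono p_norm \<epsilon>) auto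
    finally show "norm (\<integral>z. (quotient_defect t r z * cnj (p z)) * cnj (g z) \<partial>circle_measure)
        \<le> \<epsilon> * (L2_norm h * L2_norm g)"
      by (simp add: mult.assoc)
  qed
  finally show "norm (\<integral>z. quotient_defect t r z * (cnj (h z) * cnj (g z)) \<partial>circle_measure)
      \<le> \<epsilon> * (L2_norm h * L2_norm g) + e"
    by simp
qed

text \<open>Duality: the defect is tested against its own Hankel image \<open>Y\<close>, and one
  factor of the norm of \<open>Y\<close> is cancelled.\<close>

lemma L2_norm_hankel_quotient_defect:
  assumes \<delta>: "\<And>\<tau>. \<bar>\<tau> - t\<bar> < \<delta> \<Longrightarrow> ess_bounded \<epsilon> (\<lambda>z. lax_symbol (u \<tau>) z - lax_symbol (u t) z)"
    and r: "\<bar>r - t\<bar> < \<delta>" "r \<noteq> t" and h: "h \<in> L2_plus"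
  shows "L2_norm (hankel (quotient_defect t r) h) \<le> \<epsilon> * L2_norm h"
proof -
  obtain B where B: "ess_bounded B (quotient_defect t r)" using quotient_defect_bounded by blast
  define Y where "Y = hankel (quotient_defect t r) h"
  have Y: "Y \<in> L2_plus" unfolding Y_def by (rule hankel_L2_plus[OF B L2_plusD(1)[OF h]])
  have "complex_of_real ((L2_norm Y)\<^sup>2)
      = (\<integral>z. quotient_defect t r z * (cnj (h z) * cnj (Y z)) \<partial>circle_measure)"
    unfolding L2_norm_power2_complex
    using integral_szego_mult_cnj[OF L2_mult_cnj[OF B L2_plusD(1)[OF h]] Y]
    by (simp add: Y_def hankel_def mult.assoc)
  then have "(L2_norm Y)\<^sup>2 = norm (\<integral>z. quotient_defect t r z * (cnj (h z) * cnj (Y z)) \<partial>circle_measure)"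
    by (metis norm_of_real abs_power2)
  also have "\<dots> \<le> \<epsilon> * (L2_norm h * L2_norm Y)"
    by (rule quotient_defect_pairing[OF \<delta> r h Y])
  finally have le: "L2_norm Y * L2_norm Y \<le> (\<epsilon> * L2_norm h) * L2_norm Y"
    by (simp add: power2_eq_square mult.assoc)
  have \<epsilon>: "\<epsilon> \<ge> 0" using ess_bounded_nonneg[OF \<delta>[of t]] r by simp
  show ?thesis
  proof (cases "L2_norm Y = 0")
    case False
    then have "L2_norm Y > 0" using L2_norm_nonneg[of Y] by linarith
    with le show ?thesis unfolding Y_def[symmetric] by (rule mult_right_le_imp_le)
  qed (use \<epsilon> in \<open>simp add: Y_def\<close>)
qed

text \<open>Hankel operators are linear in the symbol. Here u/z represents \<open>K_op\<close> at
  both times, since it depends on \<open>u\<close> by a plain division and not through a choice of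
  representative.\<close>

lemma quotient_eq_hankel:
  assumes h: "h \<in> L2_plus"
  shows "L2_norm (\<lambda>z. (K_op (u r) h z - K_op (u t) h z) / complex_of_real (r - t)
      - commutator (D_op (u t)) (K_op (u t)) h z) = L2_norm (hankel (quotient_defect t r) h)"
proof -
  note h' = L2_plusD(1)[OF h]
  obtain B where "bounded_symbol (u t) B" using bounded_symbol_u by blast
  then interpret bounded_symbol "u t" B .
  obtain B' where "bounded_symbol (u r) B'" using bounded_symbol_u by blast
  then interpret r: bounded_symbol "u r" B' .
  obtain B'' where B'': "ess_bounded B'' (quotient_defect t r)" using quotient_defect_bounded by blast
  define c where "c = 1 / complex_of_real (r - t)"
  define Y where "Y = (\<lambda>z. c * (K_op (u r) h z - K_op (u t) h z) - commutator (D_op (u t)) (K_op (u t)) h z)"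
  have Y: "Y \<in> L2_plus"
    unfolding Y_def by (intro L2_plus_diff L2_plus_cmult K_op_L2_plus r.K_op_L2_plus commutator_L2_plus h)
  have "AE z in circle_measure. Y z = hankel (quotient_defect t r) h z"
  proof (rule L2_plus_eqI)
    show "hankel (quotient_defect t r) h \<in> L2_plus" by (rule hankel_L2_plus[OF B'' h'])
    fix n :: int assume n: "n \<ge> 0"
    note lax = ess_bounded_cmult[OF lax_symbol_bounded, of "- \<i>"]
    have "fourier (commutator (D_op (u t)) (K_op (u t)) h) n = fourier (\<lambda>z. - \<i> * lax_symbol (u t) z * cnj (h z)) n"
      using fourier_cong_AE[OF commutator_eq_hankel[OF h] L2_measurable[OF L2_plusD(1)[OF commutator_L2_plus[OF h]]]
          L2_measurable[OF L2_plusD(1)[OF hankel_L2_plus[OF lax h']]]]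
      by (simp only: fourier_hankel[OF lax h' n])
    then have "fourier Y n = c * (fourier (\<lambda>z. u r z / z * cnj (h z)) n - fourier (\<lambda>z. u t z / z * cnj (h z)) n)
        - fourier (\<lambda>z. - \<i> * lax_symbol (u t) z * cnj (h z)) n"
      unfolding Y_def
      by (simp only: fourier_diff L2_integrable L2_diff L2_cmult fourier_cmult L2_plusD(1)[OF K_op_L2_plus[OF h]]
         L2_plusD(1)[OF r.K_op_L2_plus[OF h]] L2_plusD(1)[OF commutator_L2_plus[OF h]]
         K_op_eq_hankel[OF u_bounded h'] K_op_eq_hankel[OF r.u_bounded h'] hankel_L2_plus[OF w_bounded h']
         hankel_L2_plus[OF r.w_bounded h'] L2_plusD(1)
         fourier_hankel[OF w_bounded h' n] fourier_hankel[OF r.w_bounded h' n])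
    also have "\<dots> = fourier (\<lambda>z. c * (u r z / z * cnj (h z) - u t z / z * cnj (h z)) - - \<i> * lax_symbol (u t) z * cnj (h z)) n"
      by (simp only: fourier_diff L2_integrable L2_diff L2_cmult fourier_cmult L2_mult_cnj[OF w_bounded h']
          L2_mult_cnj[OF r.w_bounded h'] L2_mult_cnj[OF lax h'])
    also have "\<dots> = fourier (hankel (quotient_defect t r) h) n"
      unfolding fourier_hankel[OF B'' h' n]
      by (intro arg_cong2[where f = fourier] ext refl)
         (simp add: quotient_defect_def c_def diff_divide_distrib algebra_simps)
    finally show "fourier Y n = fourier (hankel (quotient_defect t r) h) n" .
  qed (rule Y)
  then have "L2_norm Y = L2_norm (hankel (quotient_defect t r) h)"
    by (rule L2_norm_cong_AE) (intro L2_measurable L2_plusD(1) Y hankel_L2_plus[OF B''] h)+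
  then show ?thesis by (simp add: Y_def c_def)
qed

text \<open>The radius \<delta> comes from the sup norm continuity of the symbol and is the same for
  all \<open>h\<close>; this is the uniformity that the operator norm demands.\<close>

theorem op_has_derivative_K_op:
  "op_has_derivative (\<lambda>r. K_op (u r)) (commutator (D_op (u t)) (K_op (u t))) t"
  unfolding op_has_derivative_def
proof (intro conjI allI impI)
  show "bounded_real_linear_op (K_op (u r))" for r
    using bounded_symbol_u[of r] by (auto dest: bounded_symbol.bounded_real_linear_K_op)
  show "bounded_real_linear_op (commutator (D_op (u t)) (K_op (u t)))"
    using bounded_symbol_u[of t] by (auto dest: bounded_symbol.bounded_real_linear_commutator)
  fix \<epsilon> :: real assume "\<epsilon> > 0"
  obtain \<delta> where \<delta>: "\<delta> > 0"
    "\<And>\<tau>. \<bar>\<tau> - t\<bar> < \<delta> \<Longrightarrow> ess_bounded \<epsilon> (\<lambda>z. lax_symbol (u \<tau>) z - lax_symbol (u t) z)"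
    using lax_symbol_continuous[OF \<open>\<epsilon> > 0\<close>, of t] by metis
  show "\<forall>\<^sub>F r in at t. \<forall>h\<in>L2_plus.
      L2_norm (\<lambda>z. (K_op (u r) h z - K_op (u t) h z) / complex_of_real (r - t)
        - commutator (D_op (u t)) (K_op (u t)) h z) \<le> \<epsilon> * L2_norm h"
    unfolding eventually_at
  proof (intro exI[of _ \<delta>] conjI ballI impI)
    fix r h assume "r \<noteq> t \<and> dist r t < \<delta>" and "h \<in> L2_plus"
    then show "L2_norm (\<lambda>z. (K_op (u r) h z - K_op (u t) h z) / complex_of_real (r - t)
        - commutator (D_op (u t)) (K_op (u t)) h z) \<le> \<epsilon> * L2_norm h"
      unfolding quotient_eq_hankel[OF \<open>h \<in> L2_plus\<close>]
      by (intro L2_norm_hankel_quotient_defect[OF \<delta>(2)]) (auto simp: dist_real_def)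
  qed (rule \<delta>(1))
qed

end

theorem proposition3p1:
  fixes s :: real and u :: "real \<Rightarrow> complex \<Rightarrow> complex"
  assumes "s > 1 / 2"
    and "continuous_Hs_plus s u"
    and "solves_truncated_szego u"
  shows "\<forall>t. op_has_derivative (\<lambda>r. K_op (u r)) (commutator (D_op (u t)) (K_op (u t))) t"
proof -
  interpret truncated_szego_solution s u
    using assms by unfold_locales
  show ?thesis using op_has_derivative_K_op by blast
qed

end
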